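(* For each $\mathcal{C}^\infty$-ring $A$, the mapping $$\mathrm{supp}^\infty:(\mathrm{Sper}^\infty(A),\mathrm{Har}^\infty)\to(\mathrm{Spec}^\infty(A),\mathrm{Zar}^\infty),\qquad P\mapsto P\cap(-P),$$ is a (spectral) bijection.
   Context: A $\mathcal{C}^\infty$-ring is a set $A$ together with an operation $f^A:A^n\to A$ for every $n\in\mathbb{N}$ and every smooth $f:\mathbb{R}^n\to\mathbb{R}$, such that coordinate projections are interpreted as projections and $f=h\circ(g_1,\dots,g_n)$ implies $f^A=h^A\circ(g_1^A,\dots,g_n^A)$. Homomorphisms are maps commuting with all these operations. A $\mathcal{C}^\infty$-ring has an underlying commutative unital ring (an $\mathbb{R}$-algebra); ideals are ring-theoretic ideals, and for an ideal $I$ the quotient ring $A/I$ inherits a $\mathcal{C}^\infty$-ring structure. For a $\mathcal{C}^\infty$-ring $A$ and $a\in A$, $\eta_a:A\to A\{a^{-1}\}$ is the universal $\mathcal{C}^\infty$-homomorphism out of $A$ sending $a$ to an invertible element. The $\mathcal{C}^\infty$-radical of an ideal $I\subseteq A$ is $\sqrt[\infty]{I}=\{a\in A: (A/I)\{(a+I)^{-1}\}\cong 0\}$; $I$ is $\mathcal{C}^\infty$-radical if $\sqrt[\infty]{I}=I$. $\mathrm{Spec}^\infty(A)$ is the set of (proper) prime ideals of $A$ that are $\mathcal{C}^\infty$-radical, with the smooth Zariski topology $\mathrm{Zar}^\infty$ having as basic open sets $D^\infty(a)=\{\mathfrak{p}\in\mathrm{Spec}^\infty(A):a\notin\mathfrak{p}\}$,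 $a\in A$; it is a spectral space. A $\mathcal{C}^\infty$-ordering in $A$ is a subset $P\subseteq A$ such that $P+P\subseteq P$, $P\cdot P\subseteq P$, $P\cup(-P)=A$, and $P\cap(-P)\in\mathrm{Spec}^\infty(A)$. The support of $P$ is $\mathrm{supp}^\infty(P)=P\cap(-P)$. The $\mathcal{C}^\infty$-real spectrum $\mathrm{Sper}^\infty(A)$ is the set of all $\mathcal{C}^\infty$-orderings in $A$, with the (spectral) smooth Harrison topology $\mathrm{Har}^\infty$ generated by the sets $H^\infty(a)=\{P\in\mathrm{Sper}^\infty(A):a\in P\setminus\mathrm{supp}^\infty(P)\}$, $a\in A$. A map between spectral spaces is spectral if it is continuous and the preimage of every quasi-compact open set is quasi-compact. *)

theory Defs
  imports "HOL-Analysis.Analysis" "HOL-Algebra.QuotRing"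
begin

section \<open>Smooth functions on real coordinate space\<close>

text \<open>
  Points of $n$-dimensional real space, and $n$-tuples of elements of a ring, are lists of
  length $n$. A function of $n$ real variables is a total function on lists, of which
  only the values on lists of length $n$ matter.
\<close>

definition partial_deriv :: "nat \<Rightarrow> (real list \<Rightarrow> real) \<Rightarrow> real list \<Rightarrow> real" where
  "partial_deriv i f x = deriv (\<lambda>t. f (x[i := t])) (x ! i)"

definition continuous_fun :: "nat \<Rightarrow> (real list \<Rightarrow> real) \<Rightarrow> bool" where
  "continuous_fun n f \<longleftrightarrow>
     continuous_map (Euclidean_space n) euclideanreal (\<lambda>v. f (map v [0..<n]))"

primrec Ck_fun :: "nat \<Rightarrow> nat \<Rightarrow> (real list \<Rightarrow> real) \<Rightarrow> bool" where
  "Ck_fun n 0 f \<longleftrightarrow> continuous_fun n f"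
| "Ck_fun n (Suc k) f \<longleftrightarrow> continuous_fun n f \<and>
     (\<forall>i<n. (\<forall>x. length x = n \<longrightarrow> (\<lambda>t. f (x[i := t])) differentiable at (x ! i))
            \<and> Ck_fun n k (partial_deriv i f))"

definition smooth_fun :: "nat \<Rightarrow> (real list \<Rightarrow> real) \<Rightarrow> bool" where
  "smooth_fun n f \<longleftrightarrow> (\<forall>k. Ck_fun n k f)"


section \<open>Smooth rings\<close>

text \<open>
  The arity of an operation is the length of the list it is applied to. That \<open>oper A f as\<close>
  depends only on the restriction of \<open>f\<close> to lists of that length follows from the axioms
  \<open>proj\<close> and \<open>comp\<close> below (compose with the projection of arity 1), since the hypothesis
  of \<open>comp\<close> only concerns lists of that length.
\<close>

record 'a cinf_struct = "'a partial_object" +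
  oper :: "(real list \<Rightarrow> real) \<Rightarrow> 'a list \<Rightarrow> 'a"

locale cinf_ring =
  fixes A :: "'a cinf_struct"
  assumes closed: "\<lbrakk>smooth_fun (length as) f; set as \<subseteq> carrier A\<rbrakk>
      \<Longrightarrow> oper A f as \<in> carrier A"
    and proj: "\<lbrakk>i < length as; set as \<subseteq> carrier A\<rbrakk> \<Longrightarrow> oper A (\<lambda>x. x ! i) as = as ! i"
    and comp: "\<lbrakk>smooth_fun (length as) f; smooth_fun (length gs) h;
        \<forall>g\<in>set gs. smooth_fun (length as) g; set as \<subseteq> carrier A;
        \<forall>x. length x = length as \<longrightarrow> f x = h (map (\<lambda>g. g x) gs)\<rbrakk>
      \<Longrightarrow> oper A f as = oper A h (map (\<lambda>g. oper A g as) gs)"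

definition cinf_hom :: "'a cinf_struct \<Rightarrow> 'b cinf_struct \<Rightarrow> ('a \<Rightarrow> 'b) set" where
  "cinf_hom A B = {\<phi>. \<phi> \<in> carrier A \<rightarrow> carrier B \<and>
     (\<forall>f as. smooth_fun (length as) f \<longrightarrow> set as \<subseteq> carrier A \<longrightarrow>
        \<phi> (oper A f as) = oper B f (map \<phi> as))}"

definition cinf_iso :: "'a cinf_struct \<Rightarrow> 'b cinf_struct \<Rightarrow> bool" where
  "cinf_iso A B \<longleftrightarrow> (\<exists>\<phi>\<in>cinf_hom A B. bij_betw \<phi> (carrier A) (carrier B))"

definition zero_cinf_ring :: "unit cinf_struct" where
  "zero_cinf_ring = \<lparr>carrier = UNIV, oper = (\<lambda>f as. ())\<rparr>"

definition underlying_ring :: "'a cinf_struct \<Rightarrow> 'a ring" where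
  "underlying_ring A =
    \<lparr>carrier = carrier A,
     mult = (\<lambda>a b. oper A (\<lambda>x. x ! 0 * x ! 1) [a, b]),
     one = oper A (\<lambda>x. 1) [],
     zero = oper A (\<lambda>x. 0) [],
     add = (\<lambda>a b. oper A (\<lambda>x. x ! 0 + x ! 1) [a, b])\<rparr>"

text \<open>
  As in \<^const>\<open>rcoset_mult\<close>, the operations on cosets are the union over all choices of
  representatives; by Hadamard's lemma all choices give the same coset.
\<close>

definition cinf_quot :: "'a cinf_struct \<Rightarrow> 'a set \<Rightarrow> 'a set cinf_struct" where
  "cinf_quot A I =
    \<lparr>carrier = carrier (underlying_ring A Quot I),
     oper = (\<lambda>f Xs. \<Union>as\<in>listset Xs. I +>\<^bsub>underlying_ring A\<^esub> oper A f as)\<rparr>"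


section \<open>Universally inverting an element\<close>

text \<open>
  The universal homomorphism out of \<open>A\<close> inverting \<open>a\<close> is realised by generators and relations:
  formal terms in the elements of \<open>A\<close> and one further generator, modulo the least
  congruence that imposes the axioms of smooth rings, makes \<open>Gen\<close> a homomorphism and
  makes the further generator an inverse of \<open>a\<close>. The universal property, with respect to targets
  of arbitrary type, is theorem \<open>localization_universal\<close> below.
\<close>

datatype 'a loc_term =
    Gen 'a
  | Inverse
  | Op "real list \<Rightarrow> real" "'a loc_term list"

inductive_set loc_terms :: "'a cinf_struct \<Rightarrow> 'a loc_term set" for A where
  "b \<in> carrier A \<Longrightarrow> Gen b \<in> loc_terms A"
| "Inverse \<in> loc_terms A"
| "\<lbrakk>smooth_fun (length ts) f; \<forall>t\<in>set ts. t \<in> loc_terms A\<rbrakk> \<Longrightarrow> Op f ts \<in> loc_terms A"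

inductive loc_eq :: "'a cinf_struct \<Rightarrow> 'a \<Rightarrow> 'a loc_term \<Rightarrow> 'a loc_term \<Rightarrow> bool" for A a where
  refl: "t \<in> loc_terms A \<Longrightarrow> loc_eq A a t t"
| sym: "loc_eq A a s t \<Longrightarrow> loc_eq A a t s"
| trans: "\<lbrakk>loc_eq A a s t; loc_eq A a t u\<rbrakk> \<Longrightarrow> loc_eq A a s u"
| cong: "\<lbrakk>smooth_fun (length ss) f; list_all2 (loc_eq A a) ss ts\<rbrakk>
    \<Longrightarrow> loc_eq A a (Op f ss) (Op f ts)"
| proj: "\<lbrakk>i < length ts; set ts \<subseteq> loc_terms A\<rbrakk> \<Longrightarrow> loc_eq A a (Op (\<lambda>x. x ! i) ts) (ts ! i)"
| comp: "\<lbrakk>smooth_fun (length ts) f; smooth_fun (length gs) h;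
      \<forall>g\<in>set gs. smooth_fun (length ts) g; set ts \<subseteq> loc_terms A;
      \<forall>x. length x = length ts \<longrightarrow> f x = h (map (\<lambda>g. g x) gs)\<rbrakk>
    \<Longrightarrow> loc_eq A a (Op f ts) (Op h (map (\<lambda>g. Op g ts) gs))"
| gen: "\<lbrakk>smooth_fun (length as) f; set as \<subseteq> carrier A\<rbrakk>
    \<Longrightarrow> loc_eq A a (Op f (map Gen as)) (Gen (oper A f as))"
| inverse: "loc_eq A a (Op (\<lambda>x. x ! 0 * x ! 1) [Gen a, Inverse]) (Op (\<lambda>x. 1) [])"

definition loc_class :: "'a cinf_struct \<Rightarrow> 'a \<Rightarrow> 'a loc_term \<Rightarrow> 'a loc_term set" where
  "loc_class A a t = {s. loc_eq A a t s}"

definition localization :: "'a cinf_struct \<Rightarrow> 'a \<Rightarrow> 'a loc_term set cinf_struct" where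
  "localization A a =
    \<lparr>carrier = loc_class A a ` loc_terms A,
     oper = (\<lambda>f Xs. \<Union>ts\<in>listset Xs. loc_class A a (Op f ts))\<rparr>"

definition localization_map :: "'a cinf_struct \<Rightarrow> 'a \<Rightarrow> 'a \<Rightarrow> 'a loc_term set" where
  "localization_map A a b = loc_class A a (Gen b)"


section \<open>The smooth Zariski spectrum\<close>

definition cinf_radical :: "'a cinf_struct \<Rightarrow> 'a set \<Rightarrow> 'a set" where
  "cinf_radical A I =
    {a \<in> carrier A. cinf_iso (localization (cinf_quot A I) (I +>\<^bsub>underlying_ring A\<^esub> a)) zero_cinf_ring}"

definition cinf_Spec :: "'a cinf_struct \<Rightarrow> 'a set set" where
  "cinf_Spec A = {p. primeideal p (underlying_ring A) \<and> cinf_radical A p = p}"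

text \<open>
  The sets \<open>Zar_basic A a\<close> (and \<open>Har_basic A a\<close> below) with \<open>a\<close> the unit of \<open>A\<close> are the whole
  spectra, so the topologies they generate have the whole spectra as their carriers.
\<close>

definition Zar_basic :: "'a cinf_struct \<Rightarrow> 'a \<Rightarrow> 'a set set" where
  "Zar_basic A a = {p \<in> cinf_Spec A. a \<notin> p}"

definition Zar :: "'a cinf_struct \<Rightarrow> 'a set topology" where
  "Zar A = topology_generated_by (Zar_basic A ` carrier A)"


section \<open>The smooth real spectrum\<close>

definition cinf_supp :: "'a cinf_struct \<Rightarrow> 'a set \<Rightarrow> 'a set" where
  "cinf_supp A P = P \<inter> a_set_inv\<^bsub>underlying_ring A\<^esub> P"

definition cinf_ordering :: "'a cinf_struct \<Rightarrow> 'a set \<Rightarrow> bool" where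
  "cinf_ordering A P \<longleftrightarrow> P \<subseteq> carrier A \<and>
     P <+>\<^bsub>underlying_ring A\<^esub> P \<subseteq> P \<and>
     P <#>\<^bsub>underlying_ring A\<^esub> P \<subseteq> P \<and>
     P \<union> a_set_inv\<^bsub>underlying_ring A\<^esub> P = carrier A \<and>
     P \<inter> a_set_inv\<^bsub>underlying_ring A\<^esub> P \<in> cinf_Spec A"

definition cinf_Sper :: "'a cinf_struct \<Rightarrow> 'a set set" where
  "cinf_Sper A = {P. cinf_ordering A P}"

definition Har_basic :: "'a cinf_struct \<Rightarrow> 'a \<Rightarrow> 'a set set" where
  "Har_basic A a = {P \<in> cinf_Sper A. a \<in> P - cinf_supp A P}"

definition Har :: "'a cinf_struct \<Rightarrow> 'a set topology" where
  "Har A = topology_generated_by (Har_basic A ` carrier A)"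

definition spectral_map :: "'a topology \<Rightarrow> 'b topology \<Rightarrow> ('a \<Rightarrow> 'b) \<Rightarrow> bool" where
  "spectral_map X Y f \<longleftrightarrow> continuous_map X Y f \<and>
     (\<forall>U. openin Y U \<and> compactin Y U \<longrightarrow> compactin X {x \<in> topspace X. f x \<in> U})"


section \<open>Basic facts\<close>

subsection \<open>Polynomial operations are smooth\<close>

lemma continuous_fun_const [simp]: "continuous_fun n (\<lambda>x. c)"
  by (simp add: continuous_fun_def)

lemma continuous_fun_cong:
  assumes "\<And>x. length x = n \<Longrightarrow> f x = g x"
  shows "continuous_fun n f = continuous_fun n g"
  using assms by (simp add: continuous_fun_def)

lemma continuous_fun_proj: "i < n \<Longrightarrow> continuous_fun n (\<lambda>x. x ! i)"
  by (auto simp: continuous_fun_def Euclidean_space_def intro!: continuous_map_from_subtopology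
      continuous_map_product_projection)

lemma continuous_fun_add:
  "\<lbrakk>continuous_fun n f; continuous_fun n g\<rbrakk> \<Longrightarrow> continuous_fun n (\<lambda>x. f x + g x)"
  by (simp add: continuous_fun_def continuous_map_add)

lemma continuous_fun_mult:
  "\<lbrakk>continuous_fun n f; continuous_fun n g\<rbrakk> \<Longrightarrow> continuous_fun n (\<lambda>x. f x * g x)"
  by (simp add: continuous_fun_def continuous_map_real_mult)

lemma partial_deriv_cong:
  assumes "\<And>x. length x = n \<Longrightarrow> f x = g x" "length x = n"
  shows "partial_deriv i f x = partial_deriv i g x"
  using assms by (simp add: partial_deriv_def)

lemma Ck_fun_cong:
  assumes "\<And>x. length x = n \<Longrightarrow> f x = g x"
  shows "Ck_fun n k f = Ck_fun n k g"
  using assms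
proof (induction k arbitrary: f g)
  case 0
  then have "continuous_fun n f = continuous_fun n g"
    by (intro continuous_fun_cong)
  then show ?case by simp
next
  case (Suc k)
  have "Ck_fun n k (partial_deriv i f) = Ck_fun n k (partial_deriv i g)" for i
  proof (rule Suc.IH)
    show "partial_deriv i f x = partial_deriv i g x" if "length x = n" for x
      using Suc.prems that by (intro partial_deriv_cong[where n = n]) simp_all
  qed
  moreover have "continuous_fun n f = continuous_fun n g"
    using Suc.prems by (intro continuous_fun_cong) simp
  moreover have "(\<lambda>t. f (x[i := t])) = (\<lambda>t. g (x[i := t]))" if "length x = n" for x i
    using Suc.prems that by simp
  ultimately show ?case by simp
qed

lemma smooth_fun_cong:
  assumes "\<And>x. length x = n \<Longrightarrow> f x = g x"
  shows "smooth_fun n f = smooth_fun n g"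
  using Ck_fun_cong[of n f g] assms by (simp add: smooth_fun_def)

lemma Ck_fun_continuous: "Ck_fun n k f \<Longrightarrow> continuous_fun n f"
  by (cases k) auto

lemma Ck_fun_Suc: "Ck_fun n (Suc k) f \<Longrightarrow> Ck_fun n k f"
proof (induction k arbitrary: f)
  case (Suc k)
  from Suc.prems have "continuous_fun n f" by (rule Ck_fun_continuous)
  moreover have "(\<forall>x. length x = n \<longrightarrow> (\<lambda>t. f (x[i := t])) differentiable at (x ! i)) \<and>
      Ck_fun n (Suc k) (partial_deriv i f)" if "i < n" for i
    using Suc.prems that by (subst (asm) Ck_fun.simps(2)) blast
  ultimately show ?case
    using Suc.IH by (subst Ck_fun.simps(2)) blast
qed simp

lemma Ck_fun_const: "Ck_fun n k (\<lambda>x. c)"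
proof (induction k arbitrary: c)
  case (Suc k)
  have *: "partial_deriv i (\<lambda>x. c) = (\<lambda>x. 0)" for i
    by (auto simp: partial_deriv_def)
  show ?case using Suc.IH[of 0] by (simp add: *)
qed simp

lemma Ck_fun_proj:
  assumes "j < n"
  shows "Ck_fun n k (\<lambda>x. x ! j)"
proof (cases k)
  case 0
  then show ?thesis using assms by (simp add: continuous_fun_proj)
next
  case (Suc k')
  have *: "(\<lambda>t. x[i := t] ! j) = (if i = j then (\<lambda>t. t) else (\<lambda>t. x ! j))"
    if "length x = n" for x :: "real list" and i
    using that assms by auto
  have "Ck_fun n k' (partial_deriv i (\<lambda>x. x ! j))" for i
  proof -
    have "Ck_fun n k' (partial_deriv i (\<lambda>x. x ! j)) =
          Ck_fun n k' (\<lambda>x. if i = j then 1 else 0)"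
      by (rule Ck_fun_cong) (simp add: partial_deriv_def *)
    then show ?thesis by (simp add: Ck_fun_const)
  qed
  then show ?thesis using assms by (simp add: Suc continuous_fun_proj *)
qed

lemma Ck_fun_add:
  "\<lbrakk>Ck_fun n k f; Ck_fun n k g\<rbrakk> \<Longrightarrow> Ck_fun n k (\<lambda>x. f x + g x)"
proof (induction k arbitrary: f g)
  case 0
  then show ?case by (simp add: continuous_fun_add)
next
  case (Suc k)
  have "Ck_fun n k (partial_deriv i (\<lambda>x. f x + g x))" if "i < n" for i
  proof -
    have "Ck_fun n k (partial_deriv i (\<lambda>x. f x + g x)) =
          Ck_fun n k (\<lambda>x. partial_deriv i f x + partial_deriv i g x)"
      by (rule Ck_fun_cong, unfold partial_deriv_def, rule deriv_add)
         (use Suc.prems that in \<open>auto simp: field_differentiable_def has_field_derivative_def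
            real_differentiable_def\<close>)
    with Suc that show ?thesis by simp
  qed
  with Suc.prems show ?case by (auto simp: continuous_fun_add)
qed

lemma Ck_fun_mult:
  "\<lbrakk>Ck_fun n k f; Ck_fun n k g\<rbrakk> \<Longrightarrow> Ck_fun n k (\<lambda>x. f x * g x)"
proof (induction k arbitrary: f g)
  case 0
  then show ?case by (simp add: continuous_fun_mult)
next
  case (Suc k)
  have "Ck_fun n k (partial_deriv i (\<lambda>x. f x * g x))" if "i < n" for i
  proof -
    have "partial_deriv i (\<lambda>x. f x * g x) x = f x * partial_deriv i g x + partial_deriv i f x * g x"
      if "length x = n" for x
    proof -
      have "deriv (\<lambda>t. f (x[i := t]) * g (x[i := t])) (x ! i) =
          f (x[i := x ! i]) * deriv (\<lambda>t. g (x[i := t])) (x ! i) +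
          deriv (\<lambda>t. f (x[i := t])) (x ! i) * g (x[i := x ! i])"
        by (rule deriv_mult) (use Suc.prems that \<open>i < n\<close> in \<open>auto simp: field_differentiable_def
          has_field_derivative_def real_differentiable_def\<close>)
      then show ?thesis by (simp add: partial_deriv_def)
    qed
    then have "Ck_fun n k (partial_deriv i (\<lambda>x. f x * g x)) =
          Ck_fun n k (\<lambda>x. f x * partial_deriv i g x + partial_deriv i f x * g x)"
      by (rule Ck_fun_cong)
    moreover have "Ck_fun n k f" "Ck_fun n k g"
      using Suc.prems Ck_fun_Suc by blast+
    ultimately show ?thesis using Suc that by (simp add: Ck_fun_add)
  qed
  with Suc.prems show ?case by (auto simp: continuous_fun_mult)
qed

lemma smooth_fun_const [simp]: "smooth_fun n (\<lambda>x. c)"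
  by (simp add: smooth_fun_def Ck_fun_const)

lemma smooth_fun_proj: "i < n \<Longrightarrow> smooth_fun n (\<lambda>x. x ! i)"
  by (simp add: smooth_fun_def Ck_fun_proj)

lemma smooth_fun_add:
  "\<lbrakk>smooth_fun n f; smooth_fun n g\<rbrakk> \<Longrightarrow> smooth_fun n (\<lambda>x. f x + g x)"
  by (simp add: smooth_fun_def Ck_fun_add)

lemma smooth_fun_mult:
  "\<lbrakk>smooth_fun n f; smooth_fun n g\<rbrakk> \<Longrightarrow> smooth_fun n (\<lambda>x. f x * g x)"
  by (simp add: smooth_fun_def Ck_fun_mult)


subsection \<open>The underlying ring is a commutative unital ring\<close>

lemma underlying_ring_simps:
  "carrier (underlying_ring A) = carrier A"
  "a \<otimes>\<^bsub>underlying_ring A\<^esub> b = oper A (\<lambda>x. x ! 0 * x ! 1) [a, b]"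
  "\<one>\<^bsub>underlying_ring A\<^esub> = oper A (\<lambda>x. 1) []"
  "\<zero>\<^bsub>underlying_ring A\<^esub> = oper A (\<lambda>x. 0) []"
  "a \<oplus>\<^bsub>underlying_ring A\<^esub> b = oper A (\<lambda>x. x ! 0 + x ! 1) [a, b]"
  by (simp_all add: underlying_ring_def)

context cinf_ring
begin

lemma oper_cong:
  assumes "set as \<subseteq> carrier A" "smooth_fun (length as) f"
    and eq: "\<And>x. length x = length as \<Longrightarrow> f x = g x"
  shows "oper A f as = oper A g as"
proof -
  have g: "smooth_fun (length as) g"
    using assms(2) smooth_fun_cong[of "length as" f g] eq by simp
  have "oper A f as = oper A (\<lambda>x. x ! 0) (map (\<lambda>g. oper A g as) [g])"
  proof (rule comp)
    show "smooth_fun (length [g]) (\<lambda>x. x ! 0)" by (rule smooth_fun_proj) simp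
    show "\<forall>x. length x = length as \<longrightarrow> f x = map (\<lambda>g. g x) [g] ! 0"
      using eq by simp
  qed (use assms g in simp_all)
  also have "\<dots> = oper A g as"
    using proj[of 0 "[oper A g as]"] closed[OF g assms(1)] by simp
  finally show ?thesis .
qed


lemma oper_const:
  assumes "set as \<subseteq> carrier A"
  shows "oper A (\<lambda>x. c) as = oper A (\<lambda>x. c) []"
proof -
  have "oper A (\<lambda>x. c) as = oper A (\<lambda>x. c) (map (\<lambda>g. oper A g as) [])"
    by (rule comp) (use assms in simp_all)
  then show ?thesis by simp
qed

lemma oper_add:
  assumes "set as \<subseteq> carrier A" "smooth_fun (length as) f" "smooth_fun (length as) g"
  shows "oper A (\<lambda>x. f x + g x) as = oper A f as \<oplus>\<^bsub>underlying_ring A\<^esub> oper A g as"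
proof -
  have "oper A (\<lambda>x. f x + g x) as = oper A (\<lambda>x. x ! 0 + x ! 1) (map (\<lambda>g. oper A g as) [f, g])"
  proof (rule comp)
    show "smooth_fun (length as) (\<lambda>x. f x + g x)"
      using assms(2,3) by (rule smooth_fun_add)
    show "smooth_fun (length [f, g]) (\<lambda>x. x ! 0 + x ! 1)"
      by (rule smooth_fun_add; rule smooth_fun_proj; simp)
  qed (use assms in simp_all)
  then show ?thesis by (simp add: underlying_ring_simps)
qed

lemma oper_mult:
  assumes "set as \<subseteq> carrier A" "smooth_fun (length as) f" "smooth_fun (length as) g"
  shows "oper A (\<lambda>x. f x * g x) as = oper A f as \<otimes>\<^bsub>underlying_ring A\<^esub> oper A g as"
proof -
  have "oper A (\<lambda>x. f x * g x) as = oper A (\<lambda>x. x ! 0 * x ! 1) (map (\<lambda>g. oper A g as) [f, g])"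
  proof (rule comp)
    show "smooth_fun (length as) (\<lambda>x. f x * g x)"
      using assms(2,3) by (rule smooth_fun_mult)
    show "smooth_fun (length [f, g]) (\<lambda>x. x ! 0 * x ! 1)"
      by (rule smooth_fun_mult; rule smooth_fun_proj; simp)
  qed (use assms in simp_all)
  then show ?thesis by (simp add: underlying_ring_simps)
qed

lemma cring_underlying_ring: "cring (underlying_ring A)"
proof -
  let ?R = "underlying_ring A"
  note S = smooth_fun_add smooth_fun_mult smooth_fun_proj smooth_fun_const
  have cl: "a \<oplus>\<^bsub>?R\<^esub> b \<in> carrier A" "a \<otimes>\<^bsub>?R\<^esub> b \<in> carrier A"
    if "a \<in> carrier A" "b \<in> carrier A" for a b
    using that by (auto simp: underlying_ring_simps intro!: closed S)
  have cl0: "\<zero>\<^bsub>?R\<^esub> \<in> carrier A" "\<one>\<^bsub>?R\<^esub> \<in> carrier A"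
    by (auto simp: underlying_ring_simps intro!: closed)
  {
    fix a b c assume abc: "a \<in> carrier A" "b \<in> carrier A" "c \<in> carrier A"
    define E where "E f = oper A f [a, b, c]" for f
    define p0 p1 p2 :: "real list \<Rightarrow> real"
      where p: "p0 = (\<lambda>x. x ! 0)" "p1 = (\<lambda>x. x ! 1)" "p2 = (\<lambda>x. x ! 2)"
    have sp: "smooth_fun 3 p0" "smooth_fun 3 p1" "smooth_fun 3 p2"
      unfolding p by (rule smooth_fun_proj, simp)+
    have Ep: "E p0 = a" "E p1 = b" "E p2 = c"
      using proj[of 0 "[a,b,c]"] proj[of 1 "[a,b,c]"] proj[of 2 "[a,b,c]"] abc
      by (simp_all add: E_def p)
    have Ea: "E (\<lambda>x. f x + g x) = E f \<oplus>\<^bsub>?R\<^esub> E g" if "smooth_fun 3 f" "smooth_fun 3 g" for f g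
      unfolding E_def by (rule oper_add) (use that abc in \<open>simp_all add: eval_nat_numeral\<close>)
    have Em: "E (\<lambda>x. f x * g x) = E f \<otimes>\<^bsub>?R\<^esub> E g" if "smooth_fun 3 f" "smooth_fun 3 g" for f g
      unfolding E_def by (rule oper_mult) (use that abc in \<open>simp_all add: eval_nat_numeral\<close>)
    have Ec: "E (\<lambda>x. 0) = \<zero>\<^bsub>?R\<^esub>" "E (\<lambda>x. 1) = \<one>\<^bsub>?R\<^esub>"
      unfolding E_def using oper_const[of "[a,b,c]"] abc by (simp_all add: underlying_ring_simps)
    have 1: "(a \<oplus>\<^bsub>?R\<^esub> b) \<oplus>\<^bsub>?R\<^esub> c = a \<oplus>\<^bsub>?R\<^esub> (b \<oplus>\<^bsub>?R\<^esub> c)"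
      using Ea[OF smooth_fun_add[OF sp(1,2)] sp(3)] Ea[OF sp(1) smooth_fun_add[OF sp(2,3)]]
      unfolding Ea[OF sp(1,2)] Ea[OF sp(2,3)] Ep by (simp only: add.assoc)
    have 2: "(a \<otimes>\<^bsub>?R\<^esub> b) \<otimes>\<^bsub>?R\<^esub> c = a \<otimes>\<^bsub>?R\<^esub> (b \<otimes>\<^bsub>?R\<^esub> c)"
      using Em[OF smooth_fun_mult[OF sp(1,2)] sp(3)] Em[OF sp(1) smooth_fun_mult[OF sp(2,3)]]
      unfolding Em[OF sp(1,2)] Em[OF sp(2,3)] Ep by (simp only: mult.assoc)
    have 3: "a \<oplus>\<^bsub>?R\<^esub> b = b \<oplus>\<^bsub>?R\<^esub> a"
      using Ea[OF sp(1,2)] Ea[OF sp(2,1)] unfolding Ep by (simp only: add.commute)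
    have 4: "a \<otimes>\<^bsub>?R\<^esub> b = b \<otimes>\<^bsub>?R\<^esub> a"
      using Em[OF sp(1,2)] Em[OF sp(2,1)] unfolding Ep by (simp only: mult.commute)
    have 5: "(a \<oplus>\<^bsub>?R\<^esub> b) \<otimes>\<^bsub>?R\<^esub> c = (a \<otimes>\<^bsub>?R\<^esub> c) \<oplus>\<^bsub>?R\<^esub> (b \<otimes>\<^bsub>?R\<^esub> c)"
      using Em[OF smooth_fun_add[OF sp(1,2)] sp(3)]
        Ea[OF smooth_fun_mult[OF sp(1,3)] smooth_fun_mult[OF sp(2,3)]]
      unfolding Ea[OF sp(1,2)] Em[OF sp(1,3)] Em[OF sp(2,3)] Ep by (simp only: distrib_right)
    have 6: "\<zero>\<^bsub>?R\<^esub> \<oplus>\<^bsub>?R\<^esub> a = a"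
      using Ea[OF smooth_fun_const[of 3 0] sp(1)] unfolding Ec Ep by (simp add: Ep)
    have 7: "\<one>\<^bsub>?R\<^esub> \<otimes>\<^bsub>?R\<^esub> a = a"
      using Em[OF smooth_fun_const[of 3 1] sp(1)] unfolding Ec Ep by (simp add: Ep)
    have m: "smooth_fun 3 (\<lambda>x. (- 1) * p0 x)"
      by (rule smooth_fun_mult[OF smooth_fun_const sp(1)])
    have 8: "E (\<lambda>x. (- 1) * p0 x) \<oplus>\<^bsub>?R\<^esub> a = \<zero>\<^bsub>?R\<^esub>"
      using Ea[OF m sp(1)] unfolding Ep by (simp add: Ec)
    have 9: "E (\<lambda>x. (- 1) * p0 x) \<in> carrier A"
      unfolding E_def by (rule closed) (use abc m in \<open>simp_all add: eval_nat_numeral\<close>)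
    have "\<exists>y\<in>carrier A. y \<oplus>\<^bsub>?R\<^esub> a = \<zero>\<^bsub>?R\<^esub>"
      using 8 9 by (rule bexI)
    note 1 2 3 4 5 6 7 this
  } note * = this
  have "abelian_group ?R"
    by (rule abelian_groupI; (unfold underlying_ring_simps(1))?)
       (fact cl cl0 *(1) *(3)[OF _ _ cl0(1)]
         *(6)[OF _ cl0(1) cl0(1)] *(8)[OF _ cl0(1) cl0(1)])+
  moreover have "comm_monoid ?R"
    by (rule comm_monoidI; (unfold underlying_ring_simps(1))?)
       (fact cl cl0 *(2) *(4)[OF _ _ cl0(1)] *(7)[OF _ cl0(1) cl0(1)])+
  ultimately show ?thesis
    by (rule cringI) (unfold underlying_ring_simps(1), fact *(5))
qed

end


subsection \<open>The universal property of the localization\<close>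

lemma cinf_homD:
  assumes "\<phi> \<in> cinf_hom A B" "smooth_fun (length as) f" "set as \<subseteq> carrier A"
  shows "\<phi> (oper A f as) = oper B f (map \<phi> as)"
  using assms by (simp add: cinf_hom_def)

lemma listset_iff: "xs \<in> listset Xs \<longleftrightarrow> list_all2 (\<in>) xs Xs"
  by (induction Xs arbitrary: xs) (auto simp: set_Cons_def list_all2_Cons2)

lemma loc_eq_terms:
  assumes "cinf_ring A" "a \<in> carrier A" "loc_eq A a s t"
  shows "s \<in> loc_terms A \<and> t \<in> loc_terms A"
  using assms(3)
proof (induction rule: loc_eq.induct)
  case (cong ss f ts)
  then show ?case
    by (auto simp: list_all2_conv_all_nth in_set_conv_nth intro!: loc_terms.intros)
next
  case (proj i ts)
  then show ?case by (auto intro!: loc_terms.intros smooth_fun_proj)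
next
  case (comp ts f gs h)
  then show ?case by (auto intro!: loc_terms.intros)
next
  case (gen as f)
  then show ?case using cinf_ring.closed[OF assms(1)]
    by (auto intro!: loc_terms.intros)
next
  case inverse
  then show ?case using assms(2)
    by (auto intro!: loc_terms.intros smooth_fun_mult smooth_fun_proj)
qed auto

lemma loc_class_eq_iff:
  assumes "t \<in> loc_terms A"
  shows "loc_class A a s = loc_class A a t \<longleftrightarrow> loc_eq A a s t"
  using assms unfolding loc_class_def
  by (auto intro: loc_eq.refl loc_eq.sym loc_eq.trans)

lemma oper_localization:
  assumes "set ts \<subseteq> loc_terms A" "smooth_fun (length ts) f"
  shows "oper (localization A a) f (map (loc_class A a) ts) = loc_class A a (Op f ts)"
proof -
  have "loc_class A a (Op f ss) = loc_class A a (Op f ts)"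
    if "ss \<in> listset (map (loc_class A a) ts)" for ss
  proof -
    have "list_all2 (loc_eq A a) ts ss"
      using that by (auto simp: listset_iff list_all2_conv_all_nth loc_class_def)
    with assms(2) have "loc_eq A a (Op f ts) (Op f ss)"
      by (rule loc_eq.cong)
    then have "loc_eq A a (Op f ss) (Op f ts)"
      by (rule loc_eq.sym)
    moreover have "Op f ts \<in> loc_terms A"
      using assms by (intro loc_terms.intros(3)) auto
    ultimately show ?thesis by (simp only: loc_class_eq_iff)
  qed
  moreover have "ts \<in> listset (map (loc_class A a) ts)"
  proof -
    have "ts ! i \<in> loc_class A a (ts ! i)" if "i < length ts" for i
    proof -
      have "ts ! i \<in> loc_terms A" using assms(1) nth_mem[OF that] by blast
      then show ?thesis by (simp add: loc_class_def loc_eq.refl)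
    qed
    then show ?thesis by (simp add: listset_iff list_all2_conv_all_nth)
  qed
  ultimately have "(\<lambda>ss. loc_class A a (Op f ss)) ` listset (map (loc_class A a) ts) =
      {loc_class A a (Op f ts)}"
    by blast
  then show ?thesis by (simp add: localization_def)
qed

lemma carrier_localization: "carrier (localization A a) = loc_class A a ` loc_terms A"
  by (simp add: localization_def)

lemma localization_reps:
  assumes "set Xs \<subseteq> carrier (localization A a)"
  obtains ts where "set ts \<subseteq> loc_terms A" "Xs = map (loc_class A a) ts"
proof -
  have "\<exists>ts. set ts \<subseteq> loc_terms A \<and> Xs = map (loc_class A a) ts"
    using assms
  proof (induction Xs)
    case (Cons X Xs)
    from Cons.prems have "set Xs \<subseteq> carrier (localization A a)" by simp
    from Cons.IH[OF this] obtain ts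
      where "set ts \<subseteq> loc_terms A" "Xs = map (loc_class A a) ts" by (elim exE conjE)
    moreover obtain t where "t \<in> loc_terms A" "X = loc_class A a t"
      using Cons.prems by (auto simp: carrier_localization)
    ultimately have "set (t # ts) \<subseteq> loc_terms A \<and> X # Xs = map (loc_class A a) (t # ts)" by simp
    then show ?case by (rule exI)
  qed simp
  with that show thesis by (elim exE conjE)
qed

theorem cinf_ring_localization:
  assumes "cinf_ring A" "a \<in> carrier A"
  shows "cinf_ring (localization A a)"
proof
  fix f :: "real list \<Rightarrow> real" and Xs
  assume f: "smooth_fun (length Xs) f" and "set Xs \<subseteq> carrier (localization A a)"
  then obtain ts where "set ts \<subseteq> loc_terms A" "Xs = map (loc_class A a) ts"
    by (metis localization_reps)
  with f show "oper (localization A a) f Xs \<in> carrier (localization A a)"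
    by (auto simp: oper_localization carrier_localization intro!: imageI loc_terms.intros)
next
  fix i Xs
  assume i: "i < length Xs" and "set Xs \<subseteq> carrier (localization A a)"
  then obtain ts where ts: "set ts \<subseteq> loc_terms A" "Xs = map (loc_class A a) ts"
    by (metis localization_reps)
  with i have "ts ! i \<in> loc_terms A" by auto
  with i ts show "oper (localization A a) (\<lambda>x. x ! i) Xs = Xs ! i"
    by (auto simp: oper_localization smooth_fun_proj loc_class_eq_iff intro!: loc_eq.proj)
next
  fix f h :: "real list \<Rightarrow> real" and gs Xs
  assume *: "smooth_fun (length Xs) f" "smooth_fun (length gs) h"
      "\<forall>g\<in>set gs. smooth_fun (length Xs) g"
      "\<forall>x. length x = length Xs \<longrightarrow> f x = h (map (\<lambda>g. g x) gs)"
    and "set Xs \<subseteq> carrier (localization A a)"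
  then obtain ts where ts: "set ts \<subseteq> loc_terms A" "Xs = map (loc_class A a) ts"
    by (metis localization_reps)
  have 1: "set (map (\<lambda>g. Op g ts) gs) \<subseteq> loc_terms A"
    using * ts by (auto intro!: loc_terms.intros)
  have 2: "map (\<lambda>g. oper (localization A a) g Xs) gs = map (loc_class A a) (map (\<lambda>g. Op g ts) gs)"
    using * ts by (auto simp: oper_localization)
  have "Op h (map (\<lambda>g. Op g ts) gs) \<in> loc_terms A"
    using * 1 by (auto intro!: loc_terms.intros)
  moreover have "loc_eq A a (Op f ts) (Op h (map (\<lambda>g. Op g ts) gs))"
    using * ts by (intro loc_eq.comp) auto
  ultimately show "oper (localization A a) f Xs =
      oper (localization A a) h (map (\<lambda>g. oper (localization A a) g Xs) gs)"
    unfolding 2 using oper_localization[OF 1, of h a] oper_localization[OF ts(1), of f a] * ts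
    by (simp add: loc_class_eq_iff)
qed

theorem localization_map_hom:
  assumes "cinf_ring A"
  shows "localization_map A a \<in> cinf_hom A (localization A a)"
  unfolding cinf_hom_def
proof (intro CollectI conjI allI impI)
  show "localization_map A a \<in> carrier A \<rightarrow> carrier (localization A a)"
    by (auto simp: localization_map_def carrier_localization intro!: imageI loc_terms.intros)
  fix f :: "real list \<Rightarrow> real" and as
  assume *: "smooth_fun (length as) f" "set as \<subseteq> carrier A"
  have "oper (localization A a) f (map (localization_map A a) as) =
        oper (localization A a) f (map (loc_class A a) (map Gen as))"
    by (simp add: localization_map_def[abs_def] comp_def)
  also have "\<dots> = loc_class A a (Op f (map Gen as))"
    by (rule oper_localization) (use * in \<open>auto intro!: loc_terms.intros\<close>)
  also have "\<dots> = loc_class A a (Gen (oper A f as))"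
    using * cinf_ring.closed[OF assms] by (auto simp: loc_class_eq_iff loc_terms.intros intro!: loc_eq.gen)
  finally show "localization_map A a (oper A f as) =
      oper (localization A a) f (map (localization_map A a) as)"
    by (simp add: localization_map_def)
qed

lemma localization_inverse:
  assumes "cinf_ring A" "a \<in> carrier A"
  shows "localization_map A a a \<otimes>\<^bsub>underlying_ring (localization A a)\<^esub> loc_class A a Inverse =
    \<one>\<^bsub>underlying_ring (localization A a)\<^esub>"
proof -
  have "loc_class A a (Op (\<lambda>x. x ! 0 * x ! 1) [Gen a, Inverse]) = loc_class A a (Op (\<lambda>x. 1) [])"
  proof (subst loc_class_eq_iff)
    show "Op (\<lambda>x. 1) [] \<in> loc_terms A" by (rule loc_terms.intros(3)) simp_all
  qed (rule loc_eq.inverse)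
  moreover have "oper (localization A a) (\<lambda>x. x ! 0 * x ! 1) (map (loc_class A a) [Gen a, Inverse]) =
      loc_class A a (Op (\<lambda>x. x ! 0 * x ! 1) [Gen a, Inverse])"
    by (rule oper_localization)
       (use assms in \<open>auto intro!: loc_terms.intros smooth_fun_mult smooth_fun_proj\<close>)
  moreover have "oper (localization A a) (\<lambda>x. 1) (map (loc_class A a) []) =
      loc_class A a (Op (\<lambda>x. 1) [])"
    by (rule oper_localization) auto
  ultimately show ?thesis
    by (simp add: underlying_ring_simps localization_map_def)
qed

theorem localization_map_unit:
  assumes "cinf_ring A" "a \<in> carrier A"
  shows "localization_map A a a \<in> Units (underlying_ring (localization A a))"
proof -
  interpret L: cring "underlying_ring (localization A a)"
    using cinf_ring.cring_underlying_ring[OF cinf_ring_localization[OF assms]] .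
  have cl: "loc_class A a Inverse \<in> carrier (underlying_ring (localization A a))"
    "localization_map A a a \<in> carrier (underlying_ring (localization A a))"
    unfolding underlying_ring_simps(1) carrier_localization localization_map_def
    using assms by (blast intro: loc_terms.intros)+
  then show ?thesis
    using localization_inverse[OF assms] L.m_comm[OF cl] unfolding Units_def by force
qed

primrec loc_eval :: "'b cinf_struct \<Rightarrow> ('a \<Rightarrow> 'b) \<Rightarrow> 'b \<Rightarrow> 'a loc_term \<Rightarrow> 'b" where
  "loc_eval B \<phi> c (Gen b) = \<phi> b"
| "loc_eval B \<phi> c Inverse = c"
| "loc_eval B \<phi> c (Op f ts) = oper B f (map (loc_eval B \<phi> c) ts)"

theorem localization_universal:
  fixes A :: "'a cinf_struct" and B :: "'b cinf_struct"
  assumes A: "cinf_ring A" "a \<in> carrier A" and B: "cinf_ring B"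
    and \<phi>: "\<phi> \<in> cinf_hom A B" "\<phi> a \<in> Units (underlying_ring B)"
  shows "\<exists>\<psi>\<in>cinf_hom (localization A a) B.
    (\<forall>b\<in>carrier A. \<psi> (localization_map A a b) = \<phi> b) \<and>
    (\<forall>\<psi>'\<in>cinf_hom (localization A a) B.
       (\<forall>b\<in>carrier A. \<psi>' (localization_map A a b) = \<phi> b) \<longrightarrow>
       (\<forall>x\<in>carrier (localization A a). \<psi>' x = \<psi> x))"
proof -
  interpret B: cinf_ring B by fact
  interpret RB: cring "underlying_ring B" by (rule B.cring_underlying_ring)
  have \<phi>_op: "\<phi> (oper A f as) = oper B f (map \<phi> as)"
    if "smooth_fun (length as) f" "set as \<subseteq> carrier A" for f as
    using \<phi>(1) that by (auto simp: cinf_hom_def)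
  have \<phi>_cl: "\<phi> b \<in> carrier B" if "b \<in> carrier A" for b
    using \<phi>(1) that by (auto simp: cinf_hom_def)
  obtain c where c: "c \<in> carrier B"
    "\<phi> a \<otimes>\<^bsub>underlying_ring B\<^esub> c = \<one>\<^bsub>underlying_ring B\<^esub>"
    using \<phi>(2) unfolding Units_def by (auto simp: underlying_ring_simps(1))
  let ?e = "loc_eval B \<phi> c"
  have e_cl: "?e t \<in> carrier B" if "t \<in> loc_terms A" for t
    using that by induction (auto simp: \<phi>_cl c intro!: B.closed)
  have e_eq: "?e s = ?e t" if "loc_eq A a s t" for s t
    using that
  proof (induction rule: loc_eq.induct)
    case (cong ss f ts)
    have "map ?e ss = map ?e ts"
      using cong(2) by (auto simp: list_all2_conv_all_nth intro!: nth_equalityI)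
    then show ?case by simp
  next
    case (proj i ts)
    then show ?case using B.proj[of i "map ?e ts"] e_cl by auto
  next
    case (comp ts f gs h)
    then show ?case using B.comp[of "map ?e ts" f gs h] e_cl by (auto simp: comp_def)
  next
    case (gen as f)
    then show ?case by (simp add: \<phi>_op comp_def)
  next
    case inverse
    then show ?case using c by (simp add: underlying_ring_simps)
  qed auto
  define \<psi> where "\<psi> X = ?e (SOME t. t \<in> X)" for X
  have \<psi>: "\<psi> (loc_class A a t) = ?e t" if "t \<in> loc_terms A" for t
  proof -
    have "t \<in> loc_class A a t" using that by (simp add: loc_class_def loc_eq.refl)
    then have "(SOME s. s \<in> loc_class A a t) \<in> loc_class A a t" by (rule someI)
    then have "loc_eq A a t (SOME s. s \<in> loc_class A a t)" by (simp add: loc_class_def)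
    then show ?thesis unfolding \<psi>_def using e_eq by metis
  qed
  have \<psi>_hom: "\<psi> \<in> cinf_hom (localization A a) B"
    unfolding cinf_hom_def
  proof (intro CollectI conjI allI impI)
    show "\<psi> \<in> carrier (localization A a) \<rightarrow> carrier B"
      by (auto simp: carrier_localization \<psi> e_cl)
    fix f :: "real list \<Rightarrow> real" and Xs
    assume f: "smooth_fun (length Xs) f" and "set Xs \<subseteq> carrier (localization A a)"
    then obtain ts where ts: "set ts \<subseteq> loc_terms A" "Xs = map (loc_class A a) ts"
      by (metis localization_reps)
    have eq: "map \<psi> Xs = map ?e ts" using ts by (auto simp: \<psi>)
    moreover have "Op f ts \<in> loc_terms A" using f ts by (auto intro!: loc_terms.intros)
    ultimately show "\<psi> (oper (localization A a) f Xs) = oper B f (map \<psi> Xs)"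
      unfolding eq using f ts by (simp add: oper_localization \<psi>)
  qed
  have \<psi>_map: "\<psi> (localization_map A a b) = \<phi> b" if "b \<in> carrier A" for b
    using that by (simp add: localization_map_def \<psi> loc_terms.intros)
  have uniq: "\<psi>' x = \<psi> x"
    if \<psi>': "\<psi>' \<in> cinf_hom (localization A a) B"
      "\<forall>b\<in>carrier A. \<psi>' (localization_map A a b) = \<phi> b"
      and x: "x \<in> carrier (localization A a)" for \<psi>' x
  proof -
    have inv: "\<psi>' (loc_class A a Inverse) = c"
    proof -
      let ?d = "\<psi>' (loc_class A a Inverse)"
      have i: "loc_class A a Inverse \<in> carrier (localization A a)"
        by (auto simp: carrier_localization intro!: imageI loc_terms.intros)
      have g: "localization_map A a a \<in> carrier (localization A a)"
        using A by (auto simp: carrier_localization localization_map_def intro!: imageI loc_terms.intros)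
      have d: "?d \<in> carrier B" using \<psi>'(1) i by (auto simp: cinf_hom_def)
      have s: "smooth_fun (length [localization_map A a a, loc_class A a Inverse])
          (\<lambda>x. x ! 0 * x ! 1)"
        by (auto intro!: smooth_fun_mult smooth_fun_proj)
      have "\<psi>' (oper (localization A a) (\<lambda>x. x ! 0 * x ! 1)
            [localization_map A a a, loc_class A a Inverse]) =
          oper B (\<lambda>x. x ! 0 * x ! 1) (map \<psi>' [localization_map A a a, loc_class A a Inverse])"
        by (rule cinf_homD[OF \<psi>'(1) s]) (use i g in simp)
      moreover have "\<psi>' (oper (localization A a) (\<lambda>x. 1) []) = oper B (\<lambda>x. 1) (map \<psi>' [])"
        by (rule cinf_homD[OF \<psi>'(1)]) simp_all
      ultimately have "\<phi> a \<otimes>\<^bsub>underlying_ring B\<^esub> ?d = \<one>\<^bsub>underlying_ring B\<^esub>"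
        using localization_inverse[OF A] \<psi>'(2) A(2) by (simp add: underlying_ring_simps)
      with c d \<phi>_cl[OF A(2)] show ?thesis
        using RB.inv_unique'[of "\<phi> a" ?d] RB.inv_unique'[of "\<phi> a" c] RB.m_comm
        by (metis underlying_ring_simps(1))
    qed
    have "\<psi>' (loc_class A a t) = ?e t" if "t \<in> loc_terms A" for t
      using that
    proof induction
      case (1 b)
      then show ?case using \<psi>'(2) by (simp add: localization_map_def)
    next
      case 2
      then show ?case by (simp add: inv)
    next
      case (3 ts f)
      have ts: "set ts \<subseteq> loc_terms A" using 3 by auto
      have eq: "map \<psi>' (map (loc_class A a) ts) = map ?e ts" using 3 by auto
      have "\<psi>' (oper (localization A a) f (map (loc_class A a) ts)) =
          oper B f (map \<psi>' (map (loc_class A a) ts))"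
        by (rule cinf_homD[OF \<psi>'(1)]) (use 3(1) ts in \<open>auto simp: carrier_localization\<close>)
      then show ?case unfolding eq using oper_localization[OF ts 3(1), of a] by simp
    qed
    with x show ?thesis by (auto simp: carrier_localization \<psi>)
  qed
  show ?thesis using \<psi>_hom \<psi>_map uniq by blast
qed

end

theory Submission
  imports Defs "HOL-Real_Asymp.Real_Asymp"
begin

text \<open>
  A prime \<open>p\<close> of the smooth spectrum satisfies a Nullstellensatz: if the smooth function \<open>g\<close> vanishes
  on the zeros of the smooth function \<open>f\<close> and \<open>f(a\<^sub>1, \<dots>, a\<^sub>n) \<in> p\<close>, then \<open>g(a\<^sub>1, \<dots>, a\<^sub>n) \<in> p\<close>,
  since otherwise \<open>f\<^sup>2 + (g y - 1)\<^sup>2\<close> would be both zero and a unit in the localization of the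
  quotient by \<open>p\<close>. Let \<open>k\<close> be a smooth function that is positive on the positive reals and zero
  elsewhere. By the Nullstellensatz \<open>{a. k(- a) \<in> p}\<close> is an ordering with support \<open>p\<close>. Choosing
  \<open>k(t) = t\<^bsup>1/2\<^esup> exp(- 1/t)\<close>, the square of \<open>k(- a)\<close> is \<open>- a\<close> times a square, which forces
  \<open>k(- a)\<close> into the support of every ordering containing \<open>a\<close>; hence the ordering is unique.
  Finally \<open>a\<close> is strictly positive exactly if \<open>k(a)\<close> is not in the support, so the subbasic sets of
  the two topologies correspond and the support map is even a homeomorphism.
\<close>

section \<open>Calculus of smooth functions\<close>

lemma smooth_fun_minus: "smooth_fun n f \<Longrightarrow> smooth_fun n (\<lambda>x. - f x)"
  using smooth_fun_mult[OF smooth_fun_const[of n "-1"]] by fastforce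

lemma smooth_fun_diff: "smooth_fun n f \<Longrightarrow> smooth_fun n g \<Longrightarrow> smooth_fun n (\<lambda>x. f x - g x)"
  using smooth_fun_add[OF _ smooth_fun_minus] by fastforce

text \<open>\<open>Euclidean_space n\<close> consists of the sequences that vanish from index
  \<open>n\<close> on, with the product topology. That is the topology of the function type, so the
  calculus of \<open>continuous_on\<close> becomes applicable.\<close>

lemma continuous_fun_iff:
  "continuous_fun n f \<longleftrightarrow> continuous_on {v. \<forall>i\<ge>n. v i = 0} (\<lambda>v. f (map v [0..<n]))"
  by (simp add: continuous_fun_def Euclidean_space_def euclidean_product_topology)

lemma continuous_fun_substitute:
  assumes f: "continuous_fun n f" and u: "\<And>i. i < n \<Longrightarrow> continuous_on S (u i)"
  shows "continuous_on S (\<lambda>s. f (map (\<lambda>i. u i s) [0..<n]))"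
proof -
  \<comment> \<open>Padding with zeros from index \<open>n\<close> on places \<open>w s\<close> in
    the set on which \<open>continuous_fun_iff\<close> states continuity.\<close>
  define w where "w s i = (if i < n then u i s else 0)" for s i
  have w: "continuous_on S w"
  proof (rule continuous_on_coordinatewise_then_product)
    show "continuous_on S (\<lambda>s. w s i)" for i
      using u by (cases "i < n") (auto simp: w_def)
  qed
  have "continuous_on S (\<lambda>s. f (map (w s) [0..<n]))"
    by (rule continuous_on_compose2[OF f[unfolded continuous_fun_iff] w]) (auto simp: w_def)
  moreover have "map (w s) [0..<n] = map (\<lambda>i. u i s) [0..<n]" for s
    by (simp add: w_def)
  ultimately show ?thesis by simp
qed

lemma continuous_fun_real_compose:
  assumes "continuous_fun n f" "\<And>x. length x = n \<Longrightarrow> isCont \<phi> (f x)"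
  shows "continuous_fun n (\<lambda>x. \<phi> (f x))"
proof -
  have "continuous_on {f x | x. length x = n} \<phi>"
    using assms(2) by (force intro!: continuous_at_imp_continuous_on)
  then show ?thesis
    using assms(1) unfolding continuous_fun_iff by (rule continuous_on_compose2) auto
qed

section \<open>Functions of \<open>n\<close> variables as functions of \<open>n + 1\<close>
  variables\<close>

lemma continuous_fun_lift:
  assumes "continuous_fun n f"
  shows "continuous_fun (Suc n) (\<lambda>x. f (take n x))"
proof -
  have "continuous_on {v. \<forall>i\<ge>Suc n. v i = 0} (\<lambda>v. f (map (\<lambda>i. v i) [0..<n]))"
    by (rule continuous_fun_substitute[OF assms])
      (rule continuous_on_product_then_coordinatewise, rule continuous_on_id)
  then show ?thesis
    by (simp add: continuous_fun_iff take_map del: upt_Suc)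
qed

text \<open>Differentiation in a direction \<open>i < n\<close> commutes with \<open>take n\<close>.
  In the new direction \<open>n\<close> the function is constant, so that derivative is
  zero.\<close>

lemma Ck_fun_lift: "Ck_fun n k f \<Longrightarrow> Ck_fun (Suc n) k (\<lambda>x. f (take n x))"
proof (induction k arbitrary: f)
  case 0
  then show ?case by (simp add: continuous_fun_lift)
next
  case (Suc k)
  have *: "f (take n (x[i := t])) = (if i < n then f ((take n x)[i := t]) else f (take n x))"
    for x :: "real list" and i t
    by (simp add: take_update_swap list_update_beyond)
  have "(\<lambda>t. f (take n (x[i := t]))) differentiable at (x ! i) \<and>
      Ck_fun (Suc n) k (partial_deriv i (\<lambda>x. f (take n x)))"
    if "i < Suc n" "length x = Suc n" for i x
  proof (cases "i < n")
    case True
    have "length (take n x) = n" using that by simp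
    then have "(\<lambda>t. f ((take n x)[i := t])) differentiable at ((take n x) ! i)"
      using Suc.prems True by (simp only: Ck_fun.simps)
    moreover have "partial_deriv i (\<lambda>x. f (take n x)) = (\<lambda>x. partial_deriv i f (take n x))"
      using True by (auto simp: partial_deriv_def *)
    moreover have "Ck_fun n k (partial_deriv i f)"
      using Suc.prems True by simp
    ultimately show ?thesis using True by (simp add: * Suc.IH)
  next
    case False
    then have "partial_deriv i (\<lambda>x. f (take n x)) = (\<lambda>x. 0)"
      by (auto simp: partial_deriv_def *)
    then show ?thesis using False by (simp add: * Ck_fun_const)
  qed
  \<comment> \<open>The claim just proved also quantifies over \<open>x\<close>. A list of the right
    length must exist before its second half, which does not mention \<open>x\<close>, can be
    extracted.\<close>
  moreover have "\<exists>x::real list. length x = Suc n" by (rule exI[of _ "replicate (Suc n) 0"]) simp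
  ultimately show ?case
    using Suc.prems by (simp add: continuous_fun_lift) blast
qed

lemma smooth_fun_lift: "smooth_fun n f \<Longrightarrow> smooth_fun (Suc n) (\<lambda>x. f (take n x))"
  by (simp add: smooth_fun_def Ck_fun_lift)

text \<open>The definition differentiates at the entry \<open>x ! i\<close> only. Moving the base
  point to \<open>x[i := a]\<close> gives the derivative at every point of the coordinate line,
  which is the form that the chain rule consumes.\<close>

lemma Ck_fun_DERIV:
  assumes "Ck_fun n (Suc k) f" "i < n" "length x = n"
  shows "((\<lambda>t. f (x[i := t])) has_field_derivative partial_deriv i f (x[i := a])) (at a)"
proof -
  have "length (x[i := a]) = n" using assms(3) by simp
  then have "(\<lambda>t. f (x[i := a, i := t])) differentiable at ((x[i := a]) ! i)"
    using assms(1,2) by (simp only: Ck_fun.simps)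
  then have "(\<lambda>t. f (x[i := t])) field_differentiable at a"
    using assms(2,3) by (simp add: field_differentiable_def has_field_derivative_def real_differentiable_def)
  then show ?thesis
    using assms(2,3) by (simp add: partial_deriv_def DERIV_deriv_iff_field_differentiable)
qed

text \<open>Allows the partial derivatives to be given by explicit formulas \<open>f' i\<close>:
  these agree with \<open>partial_deriv i f\<close> on lists of length \<open>n\<close>, and nothing
  else affects \<open>Ck_fun\<close>.\<close>

lemma Ck_fun_SucI:
  assumes "continuous_fun n f"
    and "\<And>i x. i < n \<Longrightarrow> length x = n \<Longrightarrow>
      ((\<lambda>t. f (x[i := t])) has_field_derivative f' i x) (at (x ! i))"
    and "\<And>i. i < n \<Longrightarrow> Ck_fun n k (f' i)"
  shows "Ck_fun n (Suc k) f"
proof -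
  have "(\<forall>x. length x = n \<longrightarrow> (\<lambda>t. f (x[i := t])) differentiable at (x ! i)) \<and>
      Ck_fun n k (partial_deriv i f)" if i: "i < n" for i
  proof
    show "\<forall>x. length x = n \<longrightarrow> (\<lambda>t. f (x[i := t])) differentiable at (x ! i)"
      using assms(2)[OF i] real_differentiable_def by blast
    have "Ck_fun n k (partial_deriv i f) = Ck_fun n k (f' i)"
      by (rule Ck_fun_cong) (simp add: partial_deriv_def DERIV_imp_deriv[OF assms(2)[OF i]])
    then show "Ck_fun n k (partial_deriv i f)" using assms(3)[OF i] by simp
  qed
  then show ?thesis using assms(1) by simp
qed

lemma smooth_fun_partial_deriv: "smooth_fun n f \<Longrightarrow> i < n \<Longrightarrow> smooth_fun n (partial_deriv i f)"
  unfolding smooth_fun_def by (metis Ck_fun.simps(2))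

lemma smooth_fun_DERIV:
  assumes "smooth_fun n f" "i < n" "length x = n"
  shows "((\<lambda>t. f (x[i := t])) has_field_derivative partial_deriv i f (x[i := a])) (at a)"
  using assms Ck_fun_DERIV[of n 0 f] by (simp add: smooth_fun_def del: Ck_fun.simps)

lemma smooth_fun_continuous: "smooth_fun n f \<Longrightarrow> continuous_fun n f"
  unfolding smooth_fun_def by (blast intro: Ck_fun_continuous)

lemma Ck_fun_inverse:
  assumes nz: "\<And>x. length x = n \<Longrightarrow> f x \<noteq> 0"
  shows "Ck_fun n k f \<Longrightarrow> Ck_fun n k (\<lambda>x. inverse (f x))"
proof (induction k)
  case 0
  then show ?case using nz by (simp add: continuous_fun_real_compose continuous_at_within_inverse)
next
  case (Suc k)
  show ?case
  proof (rule Ck_fun_SucI[where f' = "\<lambda>i x. (- 1) * (inverse (f x) * inverse (f x) * partial_deriv i f x)"])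
    show "continuous_fun n (\<lambda>x. inverse (f x))"
      using Suc.prems nz by (simp add: continuous_fun_real_compose continuous_at_within_inverse)
    fix i assume i: "i < n"
    \<comment> \<open>The derivative of 1/f is a product of factors 1/f and a partial derivative of
      f, so the induction hypothesis for 1/f itself closes the step.\<close>
    have "Ck_fun n k (\<lambda>x. inverse (f x))" "Ck_fun n k (partial_deriv i f)"
      using Suc Ck_fun_Suc[OF Suc.prems] i by simp_all
    then show "Ck_fun n k (\<lambda>x. (- 1) * (inverse (f x) * inverse (f x) * partial_deriv i f x))"
      by (intro Ck_fun_mult Ck_fun_const)
    fix x :: "real list" assume x: "length x = n"
    show "((\<lambda>t. inverse (f (x[i := t]))) has_field_derivative
        (- 1) * (inverse (f x) * inverse (f x) * partial_deriv i f x)) (at (x ! i))"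
      using Ck_fun_DERIV[OF Suc.prems i x, of "x ! i"] nz[OF x]
      by (auto intro!: derivative_eq_intros simp: mult_ac)
  qed
qed

lemma smooth_fun_inverse:
  "smooth_fun n f \<Longrightarrow> (\<And>x. length x = n \<Longrightarrow> f x \<noteq> 0) \<Longrightarrow> smooth_fun n (\<lambda>x. inverse (f x))"
  by (simp add: smooth_fun_def Ck_fun_inverse)

text \<open>Infinite differentiability on the line as a greatest fixed point: to show it, it
  suffices to exhibit a family of functions that is closed under differentiation.\<close>

coinductive smooth_real :: "(real \<Rightarrow> real) \<Rightarrow> bool" where
  "(\<And>t. (\<phi> has_field_derivative \<phi>' t) (at t)) \<Longrightarrow> smooth_real \<phi>' \<Longrightarrow> smooth_real \<phi>"

lemma smooth_real_imp_isCont: "smooth_real \<phi> \<Longrightarrow> isCont \<phi> t"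
  by (erule smooth_real.cases) (auto intro: DERIV_isCont)

lemma Ck_fun_real_compose: "smooth_real \<phi> \<Longrightarrow> Ck_fun n k f \<Longrightarrow> Ck_fun n k (\<lambda>x. \<phi> (f x))"
proof (induction k arbitrary: \<phi>)
  case 0
  then show ?case by (simp add: continuous_fun_real_compose smooth_real_imp_isCont)
next
  case (Suc k)
  from Suc.prems(1) obtain \<phi>' where \<phi>':
    "\<And>t. (\<phi> has_field_derivative \<phi>' t) (at t)" "smooth_real \<phi>'"
    by (cases rule: smooth_real.cases) auto
  show ?case
  proof (rule Ck_fun_SucI[where f' = "\<lambda>i x. \<phi>' (f x) * partial_deriv i f x"])
    show "continuous_fun n (\<lambda>x. \<phi> (f x))"
      using Suc.prems by (simp add: continuous_fun_real_compose smooth_real_imp_isCont)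
    fix i assume i: "i < n"
    then show "Ck_fun n k (\<lambda>x. \<phi>' (f x) * partial_deriv i f x)"
      using Suc.IH[OF \<phi>'(2)] Ck_fun_Suc[OF Suc.prems(2)] Suc.prems(2)
      by (intro Ck_fun_mult) simp_all
    fix x :: "real list" assume x: "length x = n"
    show "((\<lambda>t. \<phi> (f (x[i := t]))) has_field_derivative \<phi>' (f x) * partial_deriv i f x) (at (x ! i))"
      using DERIV_chain2[OF \<phi>'(1) Ck_fun_DERIV[OF Suc.prems(2) i x, of "x ! i"]] by simp
  qed
qed

lemma smooth_fun_real_compose:
  "smooth_real \<phi> \<Longrightarrow> smooth_fun n f \<Longrightarrow> smooth_fun n (\<lambda>x. \<phi> (f x))"
  by (simp add: smooth_fun_def Ck_fun_real_compose)


section \<open>Hadamard's lemma in one coordinate\<close>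

text \<open>
  The point \<open>y = x @ [u]\<close> of length \<open>n + 1\<close> encodes the segment from \<open>x\<close> to \<open>x[i := u]\<close>.
\<close>

definition segment :: "nat \<Rightarrow> nat \<Rightarrow> real list \<Rightarrow> real \<Rightarrow> real list" where
  "segment n i y t = (take n y)[i := (1 - t) * y ! i + t * y ! n]"

text \<open>The weight \<open>w\<close> is there because differentiation under the integral produces
  factors \<open>t\<close> and \<open>1 - t\<close>. With arbitrary continuous weights the family is
  closed under partial derivatives.\<close>

definition segment_mean :: "nat \<Rightarrow> nat \<Rightarrow> (real \<Rightarrow> real) \<Rightarrow> (real list \<Rightarrow> real) \<Rightarrow> real list \<Rightarrow> real" where
  "segment_mean n i w f y = integral {0..1} (\<lambda>t. w t * f (segment n i y t))"

text \<open>Point and parameter may both depend on \<open>s\<close>, so this yields joint continuity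
  in (point, parameter) as well as continuity in the parameter alone.\<close>

lemma continuous_on_segment:
  assumes f: "continuous_fun n f" and i: "i < n"
    and T: "continuous_on S T"
    and Y: "\<And>j. j \<le> n \<Longrightarrow> continuous_on S (\<lambda>s. Y s ! j)"
    and len: "\<And>s. s \<in> S \<Longrightarrow> length (Y s) = Suc n"
  shows "continuous_on S (\<lambda>s. f (segment n i (Y s) (T s)))"
proof -
  define u where "u j s = (if j = i then (1 - T s) * Y s ! i + T s * Y s ! n else Y s ! j)" for j s
  have "continuous_on S (\<lambda>s. f (map (\<lambda>j. u j s) [0..<n]))"
  proof (rule continuous_fun_substitute[OF f])
    show "continuous_on S (u j)" if "j < n" for j
      using that i T Y[of i] Y[of n] Y[of j]
      by (cases "j = i") (auto simp: u_def[abs_def] intro!: continuous_intros)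
  qed
  moreover have "segment n i (Y s) (T s) = map (\<lambda>j. u j s) [0..<n]" if "s \<in> S" for s
    using len[OF that] by (auto simp: segment_def u_def nth_list_update intro!: nth_equalityI)
  ultimately show ?thesis by simp
qed

lemma continuous_fun_segment_mean:
  assumes f: "continuous_fun n f" and i: "i < n" and w: "continuous_on {0..1} w"
  shows "continuous_fun (Suc n) (segment_mean n i w f)"
proof -
  let ?S = "{v :: nat \<Rightarrow> real. \<forall>i\<ge>Suc n. v i = 0}"
  have "continuous_on (?S \<times> cbox 0 1)
      (\<lambda>p. w (snd p) * f (segment n i (map (fst p) [0..<Suc n]) (snd p)))"
  proof (intro continuous_on_mult continuous_on_segment[OF f i])
    show "continuous_on (?S \<times> cbox 0 1) (\<lambda>p. w (snd p))"
      by (rule continuous_on_compose2[OF w]) (auto intro!: continuous_intros)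
    show "continuous_on (?S \<times> cbox 0 1) (\<lambda>p. map (fst p) [0..<Suc n] ! j)" if "j \<le> n" for j
      using that continuous_on_product_then_coordinatewise[OF continuous_on_fst[OF continuous_on_id]]
      by (simp del: upt_Suc)
  qed (auto intro!: continuous_intros)
  then have "continuous_on ?S (\<lambda>v. integral (cbox 0 1)
      (\<lambda>t. w t * f (segment n i (map v [0..<Suc n]) t)))"
    by (intro integral_continuous_on_param) (simp add: case_prod_unfold del: upt_Suc)
  then show ?thesis
    by (simp add: continuous_fun_iff segment_mean_def del: upt_Suc)
qed

text \<open>Differentiation under the integral sign. Coordinate \<open>j\<close> of \<open>y\<close>
  enters the segment at position \<open>q\<close> only, with slope \<open>\<alpha> t\<close>: the
  endpoint \<open>y ! n\<close> enters position \<open>i\<close> with slope \<open>t\<close>, the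
  entry \<open>y ! i\<close> with slope \<open>1 - t\<close>, and every other entry stays at its own
  position with slope 1.\<close>

lemma DERIV_segment_mean:
  assumes f: "smooth_fun n f" and i: "i < n" and w: "continuous_on {0..1} w"
    and j: "j < Suc n" and y: "length y = Suc n"
  defines "\<alpha> \<equiv> (\<lambda>t. if j = n then t else if j = i then 1 - t else 1)"
    and "q \<equiv> if j = n then i else j"
  shows "((\<lambda>s. segment_mean n i w f (y[j := s])) has_field_derivative
    segment_mean n i (\<lambda>t. w t * \<alpha> t) (partial_deriv q f) y) (at (y ! j))"
proof -
  have q: "q < n" using i j by (auto simp: q_def)
  have D: "((\<lambda>s. w t * f (segment n i (y[j := s]) t)) has_field_derivative
      w t * \<alpha> t * partial_deriv q f (segment n i (y[j := a]) t)) (at a)" for t a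
  proof -
    \<comment> \<open>For fixed \<open>t\<close> the moving entry is affine in \<open>s\<close>;
      \<open>\<beta>\<close> collects the contribution of the other end of the segment.\<close>
    define z \<beta> where "z = segment n i y t"
      and "\<beta> = (if j = n then (1 - t) * y ! i else if j = i then t * y ! n else 0)"
    have seg: "segment n i (y[j := s]) t = z[q := \<alpha> t * s + \<beta>]" for s
      using y i j unfolding z_def segment_def q_def \<alpha>_def \<beta>_def
      by (auto simp: take_update_swap nth_list_update list_update_swap list_update_beyond add.commute)
    have "length z = n" using y by (simp add: z_def segment_def)
    moreover have "((\<lambda>s. \<alpha> t * s + \<beta>) has_field_derivative \<alpha> t) (at a)"
      by (auto intro!: derivative_eq_intros)
    ultimately have "((\<lambda>s. f (z[q := \<alpha> t * s + \<beta>])) has_field_derivative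
        partial_deriv q f (z[q := \<alpha> t * a + \<beta>]) * \<alpha> t) (at a)"
      by (rule DERIV_chain2[OF smooth_fun_DERIV[OF f q]])
    from DERIV_cmult[OF this, of "w t"] show ?thesis
      unfolding seg by (simp add: mult_ac)
  qed
  have cont: "continuous_on S (\<lambda>p. h (segment n i (y[j := S1 p]) (T p)))"
    if "continuous_fun n h" "continuous_on S S1" "continuous_on S T" for S :: "(real \<times> real) set" and S1 T h
  proof (rule continuous_on_segment[OF that(1) i that(3)])
    show "continuous_on S (\<lambda>s. y[j := S1 s] ! k)" if "k \<le> n" for k
      using that y j \<open>continuous_on S S1\<close> by (cases "k = j") auto
  qed (use y in auto)
  have w\<alpha>: "continuous_on {0..1} (\<lambda>t. w t * \<alpha> t)"
    using w unfolding \<alpha>_def by (cases "j = n"; cases "j = i") (auto intro!: continuous_intros)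
  have "((\<lambda>s. integral (cbox 0 1) (\<lambda>t. w t * f (segment n i (y[j := s]) t))) has_field_derivative
    integral (cbox 0 1) (\<lambda>t. w t * \<alpha> t * partial_deriv q f (segment n i (y[j := y ! j]) t)))
    (at (y ! j) within UNIV)"
  proof (rule leibniz_rule_field_derivative)
    show "((\<lambda>s. w t * f (segment n i (y[j := s]) t)) has_field_derivative
      w t * \<alpha> t * partial_deriv q f (segment n i (y[j := s]) t)) (at s within UNIV)" for s t
      using D by simp
    show "(\<lambda>t. w t * f (segment n i (y[j := s]) t)) integrable_on cbox 0 1" for s
    proof (rule integrable_continuous, rule continuous_on_mult)
      show "continuous_on (cbox 0 1) (\<lambda>t. f (segment n i (y[j := s]) t))"
        by (rule continuous_on_segment[OF smooth_fun_continuous[OF f] i]) (use y in auto)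
    qed (use w in simp)
    show "continuous_on (UNIV \<times> cbox 0 1)
      (\<lambda>(s, t). w t * \<alpha> t * partial_deriv q f (segment n i (y[j := s]) t))"
      unfolding case_prod_unfold
    proof (rule continuous_on_mult)
      show "continuous_on (UNIV \<times> cbox 0 1) (\<lambda>p :: real \<times> real. w (snd p) * \<alpha> (snd p))"
        by (rule continuous_on_compose2[OF w\<alpha>]) (auto intro!: continuous_intros)
      show "continuous_on (UNIV \<times> cbox 0 1)
        (\<lambda>p. partial_deriv q f (segment n i (y[j := fst p]) (snd p)))"
        by (intro cont smooth_fun_continuous smooth_fun_partial_deriv f q continuous_intros)
    qed
  qed auto
  then show ?thesis by (simp add: segment_mean_def)
qed

text \<open>Each partial derivative is again a segment mean, of a partial derivative of
  \<open>f\<close> and with a new weight. The induction must therefore generalise over both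
  \<open>f\<close> and \<open>w\<close>.\<close>

lemma smooth_fun_segment_mean:
  assumes "smooth_fun n f" and i: "i < n" and "continuous_on {0..1} w"
  shows "smooth_fun (Suc n) (segment_mean n i w f)"
proof -
  have "Ck_fun (Suc n) k (segment_mean n i w f)" for k
    using assms(1,3)
  proof (induction k arbitrary: f w)
    case 0
    then show ?case by (simp add: continuous_fun_segment_mean i smooth_fun_continuous)
  next
    case (Suc k)
    show ?case
    proof (rule Ck_fun_SucI[OF _ DERIV_segment_mean])
      fix j assume "j < Suc n"
      then show "Ck_fun (Suc n) k (segment_mean n i
          (\<lambda>t. w t * (if j = n then t else if j = i then 1 - t else 1))
          (partial_deriv (if j = n then i else j) f))"
        using i Suc.prems
        by (cases "j = n"; cases "j = i")
          (auto intro!: Suc.IH smooth_fun_partial_deriv continuous_intros)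
    qed (use Suc.prems i in \<open>simp_all add: continuous_fun_segment_mean smooth_fun_continuous\<close>)
  qed
  then show ?thesis by (simp add: smooth_fun_def)
qed

text \<open>The fundamental theorem of calculus along the segment from \<open>x\<close> to
  \<open>x[i := u]\<close>. The gain is a difference quotient that is smooth in \<open>x\<close> and
  \<open>u\<close> jointly, also where \<open>u = x ! i\<close>.\<close>

lemma hadamard:
  assumes f: "smooth_fun n f" and i: "i < n" and x: "length x = n"
  shows "f (x[i := u]) = f x + (u - x ! i) * segment_mean n i (\<lambda>t. 1) (partial_deriv i f) (x @ [u])"
proof -
  have seg: "segment n i (x @ [u]) t = x[i := x ! i + t * (u - x ! i)]" for t
    using x i by (simp add: segment_def nth_append algebra_simps)
  have "((\<lambda>t. (u - x ! i) * partial_deriv i f (segment n i (x @ [u]) t)) has_integral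
      (f (x[i := x ! i + 1 * (u - x ! i)]) - f (x[i := x ! i + 0 * (u - x ! i)]))) {0..1}"
  proof (rule fundamental_theorem_of_calculus)
    fix t :: real
    have "((\<lambda>t. f (x[i := x ! i + t * (u - x ! i)])) has_real_derivative
        partial_deriv i f (x[i := x ! i + t * (u - x ! i)]) * (u - x ! i)) (at t)"
      by (rule DERIV_chain2[OF smooth_fun_DERIV[OF f i x]]) (auto intro!: derivative_eq_intros)
    then show "((\<lambda>t. f (x[i := x ! i + t * (u - x ! i)])) has_vector_derivative
        (u - x ! i) * partial_deriv i f (segment n i (x @ [u]) t)) (at t within {0..1})"
      unfolding seg has_real_derivative_iff_has_vector_derivative[symmetric]
      by (simp add: mult.commute has_field_derivative_at_within)
  qed simp
  then have "integral {0..1} (\<lambda>t. (u - x ! i) * partial_deriv i f (segment n i (x @ [u]) t)) =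
      f (x[i := u]) - f x"
    by (subst integral_unique) simp_all
  then show ?thesis by (simp add: segment_mean_def)
qed


section \<open>Flat functions\<close>

definition flat :: "real \<Rightarrow> real \<Rightarrow> real" where
  "flat r t = (if 0 < t then t powr r * exp (- 1 / t) else 0)"

text \<open>As t decreases to 0, exp(-1/t) decays faster than any power of t can grow.\<close>

lemma flat_tendsto_0: "(flat r \<longlongrightarrow> 0) (at 0)"
proof -
  have "((\<lambda>t. t powr r * exp (- 1 / t)) \<longlongrightarrow> 0) (at_right 0)"
    by real_asymp
  then have "(flat r \<longlongrightarrow> 0) (at_right 0)"
    by (rule Lim_transform_eventually)
      (auto simp: flat_def eventually_at_filter)
  moreover have "(flat r \<longlongrightarrow> 0) (at_left 0)"
    by (rule Lim_transform_eventually[OF tendsto_const]) (auto simp: flat_def eventually_at_filter)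
  ultimately show ?thesis by (simp add: filterlim_split_at)
qed

lemma DERIV_flat: "(flat r has_field_derivative r * flat (r - 1) t + flat (r - 2) t) (at t)"
proof -
  consider "t > 0" | "t = 0" | "t < 0" by linarith
  then show ?thesis
  proof cases
    case 1
    have "((\<lambda>t. t powr r * exp (- 1 / t)) has_field_derivative r * flat (r - 1) t + flat (r - 2) t) (at t)"
      using 1 by (auto intro!: derivative_eq_intros simp: flat_def powr_diff power2_eq_square field_simps)
    then show ?thesis
      by (rule has_field_derivative_transform_within_open[where S = "{0<..}"])
        (use 1 in \<open>auto simp: flat_def\<close>)
  next
    case 2
    \<comment> \<open>Dividing by \<open>h\<close> lowers the exponent by one; for
      \<open>h \<le> 0\<close> both sides are zero, with division by zero giving zero at
      \<open>h = 0\<close>. Hence the derivative at 0 is the limit of \<open>flat (r - 1)\<close>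
      there.\<close>
    have "(flat r h - flat r 0) / h = flat (r - 1) h" for h
      by (simp add: flat_def powr_diff)
    then show ?thesis
      using flat_tendsto_0[of "r - 1"] 2 by (simp add: has_field_derivative_iff flat_def[of _ 0])
  next
    case 3
    have "((\<lambda>t. 0) has_field_derivative r * flat (r - 1) t + flat (r - 2) t) (at t)"
      using 3 by (simp add: flat_def)
    then show ?thesis
      by (rule has_field_derivative_transform_within_open[where S = "{..<0}"])
        (use 3 in \<open>auto simp: flat_def\<close>)
  qed
qed

text \<open>Finite linear combinations of the functions \<open>flat r\<close>. They are closed under
  differentiation and serve as the coinduction invariant for \<open>smooth_real\<close>.\<close>

inductive flat_comb :: "(real \<Rightarrow> real) \<Rightarrow> bool" where
  "flat_comb (\<lambda>t. c * flat r t)"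
| "flat_comb f \<Longrightarrow> flat_comb g \<Longrightarrow> flat_comb (\<lambda>t. f t + g t)"

lemma flat_comb_DERIV:
  "flat_comb f \<Longrightarrow> \<exists>f'. flat_comb f' \<and> (\<forall>t. (f has_field_derivative f' t) (at t))"
proof (induction rule: flat_comb.induct)
  case (1 c r)
  have "flat_comb (\<lambda>t. (c * r) * flat (r - 1) t + c * flat (r - 2) t)"
    by (intro flat_comb.intros)
  moreover have "((\<lambda>t. c * flat r t) has_field_derivative
      (c * r) * flat (r - 1) t + c * flat (r - 2) t) (at t)" for t
    by (auto intro!: derivative_eq_intros DERIV_flat simp: algebra_simps)
  ultimately show ?case by blast
next
  case (2 f g)
  then show ?case by (blast intro: flat_comb.intros DERIV_add)
qed

lemma smooth_real_flat: "smooth_real (flat r)"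
proof -
  have "smooth_real f" if "flat_comb f" for f
    using that by (coinduction arbitrary: f) (use flat_comb_DERIV in blast)
  moreover have "flat_comb (flat r)" using flat_comb.intros(1)[of 1 r] by simp
  ultimately show ?thesis by blast
qed

lemma flat_eq_0_iff [simp]: "flat r t = 0 \<longleftrightarrow> t \<le> 0"
  by (simp add: flat_def)

text \<open>The exponent 1/2 is chosen for this identity: squaring produces the factor
  \<open>t\<close>, and the cofactor is the square of the smooth function \<open>flat 0\<close>, the
  classical exp(-1/t).\<close>

lemma flat_half_square: "flat (1/2) t * flat (1/2) t = t * (flat 0 t * flat 0 t)"
  by (simp add: flat_def powr_half_sqrt mult_ac)


section \<open>Quotients of smooth rings\<close>

context cinf_ring
begin

abbreviation R where "R \<equiv> underlying_ring A"

interpretation R: cring R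
  by (rule cring_underlying_ring)

section \<open>Evaluating composite smooth functions in a smooth ring\<close>

lemma oper_substitute:
  assumes "smooth_fun (length gs) h" "\<forall>g\<in>set gs. smooth_fun (length as) g" "set as \<subseteq> carrier A"
    "smooth_fun (length as) (\<lambda>x. h (map (\<lambda>g. g x) gs))"
  shows "oper A (\<lambda>x. h (map (\<lambda>g. g x) gs)) as = oper A h (map (\<lambda>g. oper A g as) gs)"
  using assms by (intro comp) simp_all

text \<open>The list \<open>js\<close> may omit or repeat coordinates. This covers both dropping the
  last entry of a tuple and overwriting one entry by another.\<close>

lemma oper_reindex:
  assumes "smooth_fun (length js) h" "\<forall>j\<in>set js. j < length as" "set as \<subseteq> carrier A"
    "smooth_fun (length as) (\<lambda>x. h (map ((!) x) js))"
  shows "oper A (\<lambda>x. h (map ((!) x) js)) as = oper A h (map ((!) as) js)"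
proof -
  have "oper A (\<lambda>x. h (map (\<lambda>g. g x) (map (\<lambda>j x. x ! j) js))) as =
      oper A h (map (\<lambda>g. oper A g as) (map (\<lambda>j x. x ! j) js))"
    by (rule oper_substitute) (use assms in \<open>auto simp: smooth_fun_proj comp_def\<close>)
  then show ?thesis using assms(2,3) by (simp add: comp_def proj cong: map_cong)
qed

lemma oper_uminus:
  assumes "set as \<subseteq> carrier A" "smooth_fun (length as) f"
  shows "oper A (\<lambda>x. - f x) as = \<ominus>\<^bsub>R\<^esub> oper A f as"
proof -
  have "oper A (\<lambda>x. - f x + f x) as = oper A (\<lambda>x. - f x) as \<oplus>\<^bsub>R\<^esub> oper A f as"
    by (rule oper_add) (use assms smooth_fun_minus in auto)
  moreover have "oper A (\<lambda>x. 0) as = \<zero>\<^bsub>R\<^esub>"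
    using oper_const[OF assms(1), of 0] by (simp add: underlying_ring_simps)
  ultimately show ?thesis
    using R.minus_equality[of "oper A (\<lambda>x. - f x) as" "oper A f as"] assms
    by (simp add: underlying_ring_simps(1) closed smooth_fun_minus)
qed

lemma oper_diff:
  assumes "set as \<subseteq> carrier A" "smooth_fun (length as) f" "smooth_fun (length as) g"
  shows "oper A (\<lambda>x. f x - g x) as = oper A f as \<ominus>\<^bsub>R\<^esub> oper A g as"
  using oper_add[OF assms(1,2) smooth_fun_minus[OF assms(3)]] oper_uminus[OF assms(1,3)]
  by (simp add: a_minus_def)

lemma oper_take:
  assumes "smooth_fun (length as) f" "set as \<subseteq> carrier A" "b \<in> carrier A"
  shows "oper A (\<lambda>x. f (take (length as) x)) (as @ [b]) = oper A f as"
proof -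
  have eq: "take (length as) x = map ((!) x) [0..<length as]" if "length x = Suc (length as)" for x :: "real list"
    using that by (auto intro: nth_equalityI)
  have s: "smooth_fun (length (as @ [b])) (\<lambda>x. f (take (length as) x))"
    using smooth_fun_lift[OF assms(1)] by simp
  then have s': "smooth_fun (length (as @ [b])) (\<lambda>x. f (map ((!) x) [0..<length as]))"
    by (subst (asm) smooth_fun_cong[of "length (as @ [b])"]) (simp_all add: eq)
  have "oper A (\<lambda>x. f (take (length as) x)) (as @ [b]) =
      oper A (\<lambda>x. f (map ((!) x) [0..<length as])) (as @ [b])"
    by (rule oper_cong) (use assms s in \<open>simp_all add: eq\<close>)
  also have "\<dots> = oper A f (map ((!) (as @ [b])) [0..<length as])"
    by (rule oper_reindex) (use assms s' in auto)
  also have "map ((!) (as @ [b])) [0..<length as] = as"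
    by (auto intro!: nth_equalityI simp: nth_append)
  finally show ?thesis .
qed

text \<open>Hadamard's lemma is an identity between smooth functions of \<open>n + 1\<close>
  variables; evaluating it at \<open>as @ [b]\<close> turns it into an identity in the ring.\<close>

lemma oper_update:
  assumes f: "smooth_fun (length as) f" and as: "set as \<subseteq> carrier A" and b: "b \<in> carrier A"
    and i: "i < length as"
  obtains c where "c \<in> carrier A"
    "oper A f (as[i := b]) = oper A f as \<oplus>\<^bsub>R\<^esub> (b \<ominus>\<^bsub>R\<^esub> as ! i) \<otimes>\<^bsub>R\<^esub> c"
proof -
  define n where "n = length as"
  define ys where "ys = as @ [b]"
  define h where "h = segment_mean n i (\<lambda>t. 1) (partial_deriv i f)"
  \<comment> \<open>\<open>F\<close> overwrites entry \<open>i\<close> by the last entry, so its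
    value at \<open>as @ [b]\<close> is that of \<open>f\<close> at
    \<open>as[i := b]\<close>.\<close>
  define F where "F x = f (map ((!) x) ([0..<n][i := n]))" for x
  have ys: "set ys \<subseteq> carrier A" "length ys = Suc n"
    using as b by (auto simp: ys_def n_def)
  have h: "smooth_fun (Suc n) h"
    unfolding h_def using f i by (intro smooth_fun_segment_mean smooth_fun_partial_deriv) (auto simp: n_def)
  have lift: "smooth_fun (Suc n) (\<lambda>x. f (take n x))"
    using f by (simp add: n_def smooth_fun_lift)
  have d: "smooth_fun (Suc n) (\<lambda>x. x ! n - x ! i)"
    using i by (auto intro!: smooth_fun_diff smooth_fun_proj simp: n_def)
  have F: "F x = f (take n x) + (x ! n - x ! i) * h x" if "length x = Suc n" for x
  proof -
    have "map ((!) x) ([0..<n][i := n]) = (take n x)[i := x ! n]"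
      using that i by (auto intro!: nth_equalityI simp: nth_list_update n_def)
    moreover have "take n x @ [x ! n] = x"
      using that by (metis take_Suc_conv_app_nth lessI take_all order_refl)
    ultimately show ?thesis
      using hadamard[of n f i "take n x" "x ! n"] f i that by (simp add: F_def h_def n_def)
  qed
  have sF': "smooth_fun (Suc n) (\<lambda>x. f (take n x) + (x ! n - x ! i) * h x)"
    by (intro smooth_fun_add smooth_fun_mult lift d h)
  then have sF: "smooth_fun (Suc n) F"
    by (subst smooth_fun_cong[OF F])
  have "oper A F ys = oper A f (map ((!) ys) ([0..<n][i := n]))"
    unfolding F_def by (rule oper_reindex)
      (use f sF ys in \<open>auto simp: n_def F_def[abs_def] dest!: set_update_subset_insert[THEN subsetD]\<close>)
  also have "map ((!) ys) ([0..<n][i := n]) = as[i := b]"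
    using i by (auto intro!: nth_equalityI simp: nth_list_update n_def ys_def nth_append)
  finally have "oper A f (as[i := b]) = oper A F ys" ..
  also have "\<dots> = oper A (\<lambda>x. f (take n x) + (x ! n - x ! i) * h x) ys"
    by (rule oper_cong) (use ys sF F in auto)
  also have "\<dots> = oper A (\<lambda>x. f (take n x)) ys \<oplus>\<^bsub>R\<^esub> oper A (\<lambda>x. (x ! n - x ! i) * h x) ys"
    by (rule oper_add) (use ys lift d h in \<open>simp_all add: smooth_fun_mult\<close>)
  also have "oper A (\<lambda>x. (x ! n - x ! i) * h x) ys = oper A (\<lambda>x. x ! n - x ! i) ys \<otimes>\<^bsub>R\<^esub> oper A h ys"
    by (rule oper_mult) (use ys d h in simp_all)
  also have "oper A (\<lambda>x. x ! n - x ! i) ys = oper A (\<lambda>x. x ! n) ys \<ominus>\<^bsub>R\<^esub> oper A (\<lambda>x. x ! i) ys"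
    by (rule oper_diff) (use ys i in \<open>auto simp: n_def intro!: smooth_fun_proj\<close>)
  also have "oper A (\<lambda>x. f (take n x)) ys = oper A f as"
    using oper_take[OF f as b] by (simp add: n_def ys_def)
  finally have "oper A f (as[i := b]) = oper A f as \<oplus>\<^bsub>R\<^esub> (b \<ominus>\<^bsub>R\<^esub> as ! i) \<otimes>\<^bsub>R\<^esub> oper A h ys"
    using proj[of n ys] proj[of i ys] ys i by (simp add: ys_def n_def nth_append)
  moreover have "oper A h ys \<in> carrier A" using h ys by (intro closed) auto
  ultimately show thesis using that by blast
qed

text \<open>Representatives are exchanged one entry at a time. By \<open>oper_update\<close> each
  exchange changes the value by a multiple of the difference of the two entries, which lies in
  \<open>I\<close>.\<close>

lemma oper_cong_ideal:
  assumes I: "ideal I R" and f: "smooth_fun (length as) f" and as: "set as \<subseteq> carrier A"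
    and bs: "list_all2 (\<lambda>b a. b \<in> I +>\<^bsub>R\<^esub> a) bs as"
  shows "I +>\<^bsub>R\<^esub> oper A f bs = I +>\<^bsub>R\<^esub> oper A f as"
proof -
  interpret I: ideal I R by (rule I)
  have len: "length bs = length as" using bs by (rule list_all2_lengthD)
  have bs_i: "bs ! i \<in> I +>\<^bsub>R\<^esub> as ! i" if "i < length as" for i
    using list_all2_nthD2[OF bs that] .
  have coset_carrier: "I +>\<^bsub>R\<^esub> a \<subseteq> carrier A" if "a \<in> carrier A" for a
    using R.a_r_coset_subset_G[OF I.a_subset] that by (simp add: underlying_ring_simps(1))
  have bs_carrier: "set bs \<subseteq> carrier A"
  proof
    fix b assume "b \<in> set bs"
    then obtain i where "i < length as" "b = bs ! i" by (auto simp: in_set_conv_nth len)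
    then show "b \<in> carrier A" using bs_i coset_carrier[OF subsetD[OF as nth_mem]] by blast
  qed
  \<comment> \<open>The hybrid tuple takes its first \<open>k\<close> entries from \<open>bs\<close>
    and the others from \<open>as\<close>; induction on \<open>k\<close> leads from
    \<open>as\<close> to \<open>bs\<close>.\<close>
  have "I +>\<^bsub>R\<^esub> oper A f (take k bs @ drop k as) = I +>\<^bsub>R\<^esub> oper A f as" if "k \<le> length as" for k
    using that
  proof (induction k)
    case (Suc k)
    define cs where "cs = take k bs @ drop k as"
    have cs: "set cs \<subseteq> carrier A" "length cs = length as" "cs ! k = as ! k"
      using as bs_carrier len Suc.prems
      by (auto simp: cs_def nth_append dest: in_set_takeD in_set_dropD)
    have upd: "take (Suc k) bs @ drop (Suc k) as = cs[k := bs ! k]"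
      using Suc.prems len
      by (simp add: cs_def take_Suc_conv_app_nth Cons_nth_drop_Suc[symmetric] list_update_append)
    have b: "bs ! k \<in> carrier A" "as ! k \<in> carrier A"
      using as bs_carrier len Suc.prems by auto
    obtain c where c: "c \<in> carrier A"
      "oper A f (cs[k := bs ! k]) = oper A f cs \<oplus>\<^bsub>R\<^esub> (bs ! k \<ominus>\<^bsub>R\<^esub> cs ! k) \<otimes>\<^bsub>R\<^esub> c"
      using oper_update[of cs f "bs ! k" k] f cs b Suc.prems by auto
    obtain j where j: "j \<in> I" "bs ! k = j \<oplus>\<^bsub>R\<^esub> as ! k"
      using bs_i[of k] Suc.prems by (auto simp: a_r_coset_def')
    have j_carrier: "j \<in> carrier R" using j(1) by (rule I.Icarr)
    have "bs ! k \<ominus>\<^bsub>R\<^esub> cs ! k = j"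
      using j j_carrier b(2)[folded underlying_ring_simps(1)] cs(3)
      by (simp add: a_minus_def R.a_assoc R.r_neg)
    then have mem: "(bs ! k \<ominus>\<^bsub>R\<^esub> cs ! k) \<otimes>\<^bsub>R\<^esub> c \<in> I"
      using j c by (simp add: I.I_r_closed underlying_ring_simps(1))
    have fcs: "oper A f cs \<in> carrier R"
      using f cs by (simp add: closed underlying_ring_simps(1))
    have "oper A f (cs[k := bs ! k]) \<in> I +>\<^bsub>R\<^esub> oper A f cs"
      using c(2) mem fcs R.a_comm[OF fcs I.Icarr[OF mem]] by (auto simp: a_r_coset_def')
    then have "I +>\<^bsub>R\<^esub> oper A f cs = I +>\<^bsub>R\<^esub> oper A f (cs[k := bs ! k])"
      using fcs by (rule I.a_repr_independence')
    then show ?case using Suc by (simp add: upd cs_def)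
  qed simp
  from this[of "length as"] show ?thesis using len by simp
qed

section \<open>The smooth structure on the quotient\<close>

lemma oper_quot:
  assumes I: "ideal I R" and f: "smooth_fun (length as) f" and as: "set as \<subseteq> carrier A"
  shows "oper (cinf_quot A I) f (map ((+>\<^bsub>R\<^esub>) I) as) = I +>\<^bsub>R\<^esub> oper A f as"
proof -
  interpret I: ideal I R by (rule I)
  have iff: "bs \<in> listset (map ((+>\<^bsub>R\<^esub>) I) as) \<longleftrightarrow> list_all2 (\<lambda>b a. b \<in> I +>\<^bsub>R\<^esub> a) bs as" for bs
    by (simp add: listset_iff list_all2_map2)
  have "as \<in> listset (map ((+>\<^bsub>R\<^esub>) I) as)"
    unfolding iff using subsetD[OF as nth_mem] I.a_rcos_self
    by (simp add: list_all2_conv_all_nth underlying_ring_simps(1))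
  moreover have "I +>\<^bsub>R\<^esub> oper A f bs = I +>\<^bsub>R\<^esub> oper A f as" if "bs \<in> listset (map ((+>\<^bsub>R\<^esub>) I) as)" for bs
    using that oper_cong_ideal[OF I f as] by (simp add: iff)
  ultimately have "(\<lambda>bs. I +>\<^bsub>R\<^esub> oper A f bs) ` listset (map ((+>\<^bsub>R\<^esub>) I) as) =
      {I +>\<^bsub>R\<^esub> oper A f as}"
    by blast
  then show ?thesis by (simp add: cinf_quot_def)
qed

lemma carrier_quot: "carrier (cinf_quot A I) = (+>\<^bsub>R\<^esub>) I ` carrier A"
  by (auto simp: cinf_quot_def FactRing_def A_RCOSETS_def' underlying_ring_simps(1))

lemma quot_reps:
  assumes "set Xs \<subseteq> carrier (cinf_quot A I)"
  obtains as where "set as \<subseteq> carrier A" "Xs = map ((+>\<^bsub>R\<^esub>) I) as"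
proof
  let ?rep = "inv_into (carrier A) ((+>\<^bsub>R\<^esub>) I)"
  have "?rep X \<in> carrier A \<and> I +>\<^bsub>R\<^esub> ?rep X = X" if "X \<in> set Xs" for X
    using assms that unfolding carrier_quot by (auto simp: inv_into_into f_inv_into_f)
  then show "set (map ?rep Xs) \<subseteq> carrier A" "Xs = map ((+>\<^bsub>R\<^esub>) I) (map ?rep Xs)"
    by (auto simp: map_idI)
qed

text \<open>Every list of cosets comes from a list of representatives, and there
  \<open>oper_quot\<close> lets the operations commute with the quotient map. Each axiom thus
  descends from \<open>A\<close>.\<close>

theorem cinf_ring_quot:
  assumes I: "ideal I R"
  shows "cinf_ring (cinf_quot A I)"
proof
  fix f :: "real list \<Rightarrow> real" and Xs
  assume f: "smooth_fun (length Xs) f" and "set Xs \<subseteq> carrier (cinf_quot A I)"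
  then obtain as where "set as \<subseteq> carrier A" "Xs = map ((+>\<^bsub>R\<^esub>) I) as"
    by (metis quot_reps)
  with f show "oper (cinf_quot A I) f Xs \<in> carrier (cinf_quot A I)"
    by (simp add: oper_quot[OF I] carrier_quot closed)
next
  fix i Xs
  assume i: "i < length Xs" and "set Xs \<subseteq> carrier (cinf_quot A I)"
  then obtain as where "set as \<subseteq> carrier A" "Xs = map ((+>\<^bsub>R\<^esub>) I) as"
    by (metis quot_reps)
  with i show "oper (cinf_quot A I) (\<lambda>x. x ! i) Xs = Xs ! i"
    by (simp add: oper_quot[OF I] smooth_fun_proj proj)
next
  fix f h :: "real list \<Rightarrow> real" and gs Xs
  assume *: "smooth_fun (length Xs) f" "smooth_fun (length gs) h"
      "\<forall>g\<in>set gs. smooth_fun (length Xs) g"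
      "\<forall>x. length x = length Xs \<longrightarrow> f x = h (map (\<lambda>g. g x) gs)"
    and "set Xs \<subseteq> carrier (cinf_quot A I)"
  then obtain as where as: "set as \<subseteq> carrier A" "Xs = map ((+>\<^bsub>R\<^esub>) I) as"
    by (metis quot_reps)
  have "map (\<lambda>g. oper (cinf_quot A I) g Xs) gs = map ((+>\<^bsub>R\<^esub>) I) (map (\<lambda>g. oper A g as) gs)"
    using * as by (simp add: oper_quot[OF I])
  moreover have "set (map (\<lambda>g. oper A g as) gs) \<subseteq> carrier A"
    using * as by (auto intro: closed)
  moreover have "oper A f as = oper A h (map (\<lambda>g. oper A g as) gs)"
    using * as by (intro comp) simp_all
  ultimately show "oper (cinf_quot A I) f Xs =
      oper (cinf_quot A I) h (map (\<lambda>g. oper (cinf_quot A I) g Xs) gs)"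
    using * as by (simp add: oper_quot[OF I] del: map_map)
qed

lemma cinf_iso_zeroI:
  assumes "\<one>\<^bsub>R\<^esub> = \<zero>\<^bsub>R\<^esub>"
  shows "cinf_iso A zero_cinf_ring"
proof -
  have "carrier A = {\<zero>\<^bsub>R\<^esub>}"
    using R.one_zeroD assms by (simp add: underlying_ring_simps(1))
  then have "bij_betw (\<lambda>_. ()) (carrier A) (carrier zero_cinf_ring)"
    by (simp add: zero_cinf_ring_def bij_betw_def UNIV_unit)
  then show ?thesis
    unfolding cinf_iso_def by (intro bexI[of _ "\<lambda>_. ()"]) (auto simp: cinf_hom_def zero_cinf_ring_def)
qed

end

section \<open>The smooth Nullstellensatz for radical ideals\<close>

text \<open>A smooth form of the Rabinowitsch trick. The function \<open>H\<close> has no real zero,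
  for where \<open>f\<close> vanishes so does \<open>g\<close>, and then \<open>G\<close> is -1. So
  \<open>1/H\<close> is smooth and the value of \<open>H\<close> at \<open>as @ [c]\<close> is a
  unit; but the hypotheses make this value zero.\<close>

lemma (in cinf_ring) one_eq_zeroI:
  assumes as: "set as \<subseteq> carrier A" and f: "smooth_fun (length as) f" and g: "smooth_fun (length as) g"
    and zeros: "\<And>x. length x = length as \<Longrightarrow> f x = 0 \<Longrightarrow> g x = 0"
    and f0: "oper A f as = \<zero>\<^bsub>R\<^esub>" and c: "c \<in> carrier A" "oper A g as \<otimes>\<^bsub>R\<^esub> c = \<one>\<^bsub>R\<^esub>"
  shows "\<one>\<^bsub>R\<^esub> = \<zero>\<^bsub>R\<^esub>"
proof -
  interpret R: cring R by (rule cring_underlying_ring)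
  define n where "n = length as"
  define ys where "ys = as @ [c]"
  define F where "F x = f (take n x)" for x
  define G where "G x = g (take n x) * x ! n - 1" for x :: "real list"
  define H where "H x = F x * F x + G x * G x" for x
  have ys: "set ys \<subseteq> carrier A" "length ys = Suc n" using as c by (auto simp: ys_def n_def)
  have sF: "smooth_fun (Suc n) F" unfolding F_def using f by (simp add: n_def smooth_fun_lift)
  have sg: "smooth_fun (Suc n) (\<lambda>x. g (take n x))" using g by (simp add: n_def smooth_fun_lift)
  have sG: "smooth_fun (Suc n) G"
    unfolding G_def by (intro smooth_fun_diff smooth_fun_mult sg smooth_fun_proj smooth_fun_const) simp
  have sH: "smooth_fun (Suc n) H"
    unfolding H_def by (intro smooth_fun_add smooth_fun_mult sF sG)
  have pos: "H x \<noteq> 0" if "length x = Suc n" for x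
  proof
    assume "H x = 0"
    then have "F x = 0" "G x = 0" by (auto simp: H_def sum_squares_eq_zero_iff)
    then show False using zeros[of "take n x"] that by (auto simp: F_def G_def n_def)
  qed
  have "oper A F ys = \<zero>\<^bsub>R\<^esub>"
    using oper_take[OF f as c(1)] f0 by (simp add: F_def[abs_def] n_def ys_def)
  moreover have "oper A G ys = \<zero>\<^bsub>R\<^esub>"
  proof -
    have "oper A G ys = oper A (\<lambda>x. g (take n x) * x ! n) ys \<ominus>\<^bsub>R\<^esub> oper A (\<lambda>x. 1) ys"
      unfolding G_def by (rule oper_diff) (use ys sg in \<open>auto intro!: smooth_fun_mult smooth_fun_proj\<close>)
    also have "oper A (\<lambda>x. g (take n x) * x ! n) ys =
        oper A (\<lambda>x. g (take n x)) ys \<otimes>\<^bsub>R\<^esub> oper A (\<lambda>x. x ! n) ys"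
      by (rule oper_mult) (use ys sg in \<open>auto intro!: smooth_fun_proj\<close>)
    also have "\<dots> = \<one>\<^bsub>R\<^esub>"
      using oper_take[OF g as c(1)] proj[of n ys] ys c by (simp add: n_def ys_def nth_append)
    also have "oper A (\<lambda>x. 1) ys = \<one>\<^bsub>R\<^esub>"
      using oper_const[OF ys(1), of 1] by (simp add: underlying_ring_simps)
    finally show ?thesis by (simp add: a_minus_def R.r_neg)
  qed
  moreover have "oper A H ys = oper A F ys \<otimes>\<^bsub>R\<^esub> oper A F ys \<oplus>\<^bsub>R\<^esub> oper A G ys \<otimes>\<^bsub>R\<^esub> oper A G ys"
    unfolding H_def using ys sF sG by (simp add: oper_add oper_mult smooth_fun_mult)
  ultimately have "oper A H ys = \<zero>\<^bsub>R\<^esub>" by simp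
  moreover have "oper A (\<lambda>x. inverse (H x) * H x) ys = oper A (\<lambda>x. inverse (H x)) ys \<otimes>\<^bsub>R\<^esub> oper A H ys"
    by (rule oper_mult) (use ys sH pos in \<open>auto intro!: smooth_fun_inverse\<close>)
  moreover have "oper A (\<lambda>x. inverse (H x)) ys \<in> carrier R"
    using ys sH pos by (auto simp: underlying_ring_simps(1) intro!: closed smooth_fun_inverse)
  ultimately have "oper A (\<lambda>x. inverse (H x) * H x) ys = \<zero>\<^bsub>R\<^esub>" by simp
  moreover have "oper A (\<lambda>x. 1) ys = oper A (\<lambda>x. inverse (H x) * H x) ys"
    by (rule oper_cong) (use ys pos in auto)
  moreover have "oper A (\<lambda>x. 1) ys = \<one>\<^bsub>R\<^esub>"
    using oper_const[OF ys(1), of 1] by (simp add: underlying_ring_simps)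
  ultimately show ?thesis by simp
qed

text \<open>In the localization of the quotient at the class of \<open>oper A g as\<close>, the
  value of \<open>f\<close> becomes zero and the value of \<open>g\<close> becomes invertible. By
  \<open>one_eq_zeroI\<close> this localization is the zero ring, which is what membership in the
  radical means.\<close>

lemma (in cinf_ring) cinf_radicalI:
  assumes I: "ideal I R"
    and as: "set as \<subseteq> carrier A" and f: "smooth_fun (length as) f" and g: "smooth_fun (length as) g"
    and zeros: "\<And>x. length x = length as \<Longrightarrow> f x = 0 \<Longrightarrow> g x = 0"
    and fI: "oper A f as \<in> I"
  shows "oper A g as \<in> cinf_radical A I"
proof -
  interpret I: ideal I R by (rule I)
  interpret Q: cinf_ring "cinf_quot A I" by (rule cinf_ring_quot[OF I])
  define a where "a = oper A g as"
  have a: "a \<in> carrier A" unfolding a_def using g as by (rule closed)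
  define L where "L = localization (cinf_quot A I) (I +>\<^bsub>R\<^esub> a)"
  have aQ: "I +>\<^bsub>R\<^esub> a \<in> carrier (cinf_quot A I)" using a by (simp add: carrier_quot)
  interpret L: cinf_ring L
    unfolding L_def by (rule cinf_ring_localization[OF Q.cinf_ring_axioms aQ])
  \<comment> \<open>The composite of the quotient map with the localization map; it commutes with
    all smooth operations.\<close>
  define \<eta> where "\<eta> b = localization_map (cinf_quot A I) (I +>\<^bsub>R\<^esub> a) (I +>\<^bsub>R\<^esub> b)" for b
  note lhom = localization_map_hom[OF Q.cinf_ring_axioms, of "I +>\<^bsub>R\<^esub> a", folded L_def]
  have \<eta>_carrier: "\<eta> b \<in> carrier L" if "b \<in> carrier A" for b
    using lhom that by (auto simp: \<eta>_def cinf_hom_def carrier_quot)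
  have \<eta>_oper: "\<eta> (oper A h bs) = oper L h (map \<eta> bs)"
    if "smooth_fun (length bs) h" "set bs \<subseteq> carrier A" for h bs
    using cinf_homD[OF lhom, of "map ((+>\<^bsub>R\<^esub>) I) bs" h] that
    by (simp add: oper_quot[OF I] carrier_quot \<eta>_def[abs_def] comp_def image_mono)
  have "\<one>\<^bsub>L.R\<^esub> = \<zero>\<^bsub>L.R\<^esub>"
  proof (rule L.one_eq_zeroI[of "map \<eta> as" f g])
    have "\<eta> (oper A f as) = \<eta> \<zero>\<^bsub>R\<^esub>"
      using I.a_rcos_const[OF fI] I.a_rcos_const[OF additive_subgroup.zero_closed[OF I.is_additive_subgroup]] by (simp add: \<eta>_def)
    also have "\<dots> = oper L (\<lambda>x. 0) (map \<eta> [])"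
      unfolding underlying_ring_simps(4) by (rule \<eta>_oper) auto
    finally show "oper L f (map \<eta> as) = \<zero>\<^bsub>L.R\<^esub>"
      using \<eta>_oper[OF f as] by (simp add: underlying_ring_simps)
    show "oper L g (map \<eta> as) \<otimes>\<^bsub>L.R\<^esub> loc_class (cinf_quot A I) (I +>\<^bsub>R\<^esub> a) Inverse = \<one>\<^bsub>L.R\<^esub>"
      using localization_inverse[OF Q.cinf_ring_axioms aQ] \<eta>_oper[OF g as]
      by (simp add: L_def \<eta>_def a_def)
    show "loc_class (cinf_quot A I) (I +>\<^bsub>R\<^esub> a) Inverse \<in> carrier L"
      by (simp add: L_def carrier_localization loc_terms.intros)
  qed (use as f g zeros \<eta>_carrier in auto)
  from L.cinf_iso_zeroI[OF this] show ?thesis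
    using a by (simp add: cinf_radical_def a_def L_def)
qed

lemma (in cinf_ring) nullstellensatz:
  assumes "p \<in> cinf_Spec A" "set as \<subseteq> carrier A" "smooth_fun (length as) f" "smooth_fun (length as) g"
    and "\<And>x. length x = length as \<Longrightarrow> f x = 0 \<Longrightarrow> g x = 0" "oper A f as \<in> p"
  shows "oper A g as \<in> p"
  using cinf_radicalI[of p as f g] assms primeideal.axioms(1)[of p R] by (simp add: cinf_Spec_def)


section \<open>The ordering with a given support\<close>

text \<open>A substitute for max(a, 0), which is not smooth: only the set of zeros and the
  factorisation of the square matter.\<close>

definition pos_part :: "'a cinf_struct \<Rightarrow> 'a \<Rightarrow> 'a" where
  "pos_part A a = oper A (\<lambda>x. flat (1/2) (x ! 0)) [a]"

text \<open>The condition says that the negative part of \<open>a\<close> vanishes modulo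
  \<open>p\<close>.\<close>

definition nonneg :: "'a cinf_struct \<Rightarrow> 'a set \<Rightarrow> 'a set" where
  "nonneg A p = {a \<in> carrier A. pos_part A (\<ominus>\<^bsub>underlying_ring A\<^esub> a) \<in> p}"

lemmas smooth_fun_intros = smooth_fun_const smooth_fun_proj smooth_fun_add smooth_fun_mult
  smooth_fun_minus smooth_fun_real_compose[OF smooth_real_flat]

context cinf_ring
begin

interpretation R: cring R
  by (rule cring_underlying_ring)

lemma carrier_iff: "a \<in> carrier R \<longleftrightarrow> a \<in> carrier A"
  by (simp add: underlying_ring_simps(1))

lemma ring_ops_closed [simp]:
  "a \<in> carrier A \<Longrightarrow> \<ominus>\<^bsub>R\<^esub> a \<in> carrier A"
  "a \<in> carrier A \<Longrightarrow> b \<in> carrier A \<Longrightarrow> a \<oplus>\<^bsub>R\<^esub> b \<in> carrier A"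
  "a \<in> carrier A \<Longrightarrow> b \<in> carrier A \<Longrightarrow> a \<otimes>\<^bsub>R\<^esub> b \<in> carrier A"
  "\<zero>\<^bsub>R\<^esub> \<in> carrier A" "\<one>\<^bsub>R\<^esub> \<in> carrier A"
  using R.a_inv_closed R.a_closed R.m_closed R.zero_closed R.one_closed
  unfolding carrier_iff by blast+

lemma uminus_uminus [simp]: "a \<in> carrier A \<Longrightarrow> \<ominus>\<^bsub>R\<^esub> (\<ominus>\<^bsub>R\<^esub> a) = a"
  by (simp add: R.minus_minus carrier_iff)

lemma oper_zero: "set as \<subseteq> carrier A \<Longrightarrow> oper A (\<lambda>x. 0) as = \<zero>\<^bsub>R\<^esub>"
  using oper_const[of as 0] by (simp add: underlying_ring_simps)

lemma oper_real_compose: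
  assumes "smooth_real \<phi>" "smooth_fun (length as) g" "set as \<subseteq> carrier A"
  shows "oper A (\<lambda>x. \<phi> (g x)) as = oper A (\<lambda>x. \<phi> (x ! 0)) [oper A g as]"
  using oper_substitute[of "[g]" "\<lambda>x. \<phi> (x ! 0)" as] assms
    smooth_fun_real_compose[OF assms(1) smooth_fun_proj[of 0 "Suc 0"]]
    smooth_fun_real_compose[OF assms(1,2)]
  by simp

lemma oper_flat_half:
  assumes "smooth_fun (length as) g" "set as \<subseteq> carrier A"
  shows "oper A (\<lambda>x. flat (1/2) (g x)) as = pos_part A (oper A g as)"
  unfolding pos_part_def by (rule oper_real_compose[OF smooth_real_flat assms])

lemma pos_part_closed [simp]: "a \<in> carrier A \<Longrightarrow> pos_part A a \<in> carrier A"
  unfolding pos_part_def by (rule closed) (auto intro!: smooth_fun_intros)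

lemma oper_proj_uminus: "a \<in> carrier A \<Longrightarrow> oper A (\<lambda>x. - x ! 0) [a] = \<ominus>\<^bsub>R\<^esub> a"
  using oper_uminus[of "[a]" "\<lambda>x. x ! 0"] proj[of 0 "[a]"] by (simp add: smooth_fun_proj)

lemma oper_pos_part_uminus:
  "a \<in> carrier A \<Longrightarrow> oper A (\<lambda>x. flat (1/2) (- x ! 0)) [a] = pos_part A (\<ominus>\<^bsub>R\<^esub> a)"
  by (subst oper_flat_half) (auto simp: oper_proj_uminus intro!: smooth_fun_intros)

lemma pos_part_mult_pos_part_uminus:
  assumes "a \<in> carrier A"
  shows "pos_part A a \<otimes>\<^bsub>R\<^esub> pos_part A (\<ominus>\<^bsub>R\<^esub> a) = \<zero>\<^bsub>R\<^esub>"
proof -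
  have "oper A (\<lambda>x. flat (1/2) (x ! 0) * flat (1/2) (- x ! 0)) [a] =
      pos_part A a \<otimes>\<^bsub>R\<^esub> pos_part A (\<ominus>\<^bsub>R\<^esub> a)"
    using assms by (subst oper_mult)
      (auto simp: oper_pos_part_uminus pos_part_def intro!: smooth_fun_intros)
  moreover have "(\<lambda>x :: real list. flat (1/2) (x ! 0) * flat (1/2) (- x ! 0)) = (\<lambda>x. 0)"
    by (auto simp: flat_def)
  ultimately show ?thesis using oper_zero[of "[a]"] assms by simp
qed

text \<open>Evaluates \<open>flat_half_square\<close> at \<open>a\<close>. In every ordering it ties
  the sign of the square of the positive part to the sign of \<open>a\<close>.\<close>

lemma pos_part_square:
  assumes "a \<in> carrier A"
  obtains m where "m \<in> carrier A" "pos_part A a \<otimes>\<^bsub>R\<^esub> pos_part A a = a \<otimes>\<^bsub>R\<^esub> (m \<otimes>\<^bsub>R\<^esub> m)"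
proof
  let ?m = "oper A (\<lambda>x. flat 0 (x ! 0)) [a]"
  show "?m \<in> carrier A"
    using assms by (intro closed) (auto intro!: smooth_fun_intros)
  have "oper A (\<lambda>x. flat (1/2) (x ! 0) * flat (1/2) (x ! 0)) [a] = pos_part A a \<otimes>\<^bsub>R\<^esub> pos_part A a"
    using assms by (subst oper_mult) (auto simp: pos_part_def intro!: smooth_fun_intros)
  moreover have "oper A (\<lambda>x. x ! 0 * (flat 0 (x ! 0) * flat 0 (x ! 0))) [a] =
      oper A (\<lambda>x. x ! 0) [a] \<otimes>\<^bsub>R\<^esub> (?m \<otimes>\<^bsub>R\<^esub> ?m)"
    using assms by (simp add: oper_mult smooth_fun_intros)
  ultimately show "pos_part A a \<otimes>\<^bsub>R\<^esub> pos_part A a = a \<otimes>\<^bsub>R\<^esub> (?m \<otimes>\<^bsub>R\<^esub> ?m)"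
    using proj[of 0 "[a]"] assms by (simp add: flat_half_square)
qed

section \<open>Orderings and supports in terms of elements\<close>

lemma a_set_inv_iff:
  assumes "P \<subseteq> carrier A"
  shows "a \<in> a_set_inv\<^bsub>R\<^esub> P \<longleftrightarrow> a \<in> carrier A \<and> \<ominus>\<^bsub>R\<^esub> a \<in> P"
proof
  assume "a \<in> a_set_inv\<^bsub>R\<^esub> P"
  then show "a \<in> carrier A \<and> \<ominus>\<^bsub>R\<^esub> a \<in> P"
    using assms by (auto simp: A_SET_INV_def' subset_iff)
next
  assume "a \<in> carrier A \<and> \<ominus>\<^bsub>R\<^esub> a \<in> P"
  then show "a \<in> a_set_inv\<^bsub>R\<^esub> P"
    using R.minus_minus[of a] by (force simp: A_SET_INV_def' carrier_iff)
qed

lemma cinf_ordering_iff: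
  "cinf_ordering A P \<longleftrightarrow> P \<subseteq> carrier A \<and>
    (\<forall>a\<in>P. \<forall>b\<in>P. a \<oplus>\<^bsub>R\<^esub> b \<in> P \<and> a \<otimes>\<^bsub>R\<^esub> b \<in> P) \<and>
    (\<forall>a\<in>carrier A. a \<in> P \<or> \<ominus>\<^bsub>R\<^esub> a \<in> P) \<and>
    {a \<in> P. \<ominus>\<^bsub>R\<^esub> a \<in> P} \<in> cinf_Spec A"
proof (cases "P \<subseteq> carrier A")
  case True
  have "P \<inter> a_set_inv\<^bsub>R\<^esub> P = {a \<in> P. \<ominus>\<^bsub>R\<^esub> a \<in> P}"
    using a_set_inv_iff[OF True] True by auto
  moreover have "P \<union> a_set_inv\<^bsub>R\<^esub> P = carrier A \<longleftrightarrow> (\<forall>a\<in>carrier A. a \<in> P \<or> \<ominus>\<^bsub>R\<^esub> a \<in> P)"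
    using a_set_inv_iff[OF True] True by auto
  moreover have "P <+>\<^bsub>R\<^esub> P \<subseteq> P \<longleftrightarrow> (\<forall>a\<in>P. \<forall>b\<in>P. a \<oplus>\<^bsub>R\<^esub> b \<in> P)"
    unfolding set_add_def' by blast
  moreover have "P <#>\<^bsub>R\<^esub> P \<subseteq> P \<longleftrightarrow> (\<forall>a\<in>P. \<forall>b\<in>P. a \<otimes>\<^bsub>R\<^esub> b \<in> P)"
    unfolding set_mult_def by blast
  ultimately show ?thesis
    unfolding cinf_ordering_def by (simp only:) blast
qed (simp add: cinf_ordering_def)

lemma cinf_supp_eq: "cinf_ordering A P \<Longrightarrow> cinf_supp A P = {a \<in> P. \<ominus>\<^bsub>R\<^esub> a \<in> P}"
  using a_set_inv_iff[of P] by (auto simp: cinf_supp_def cinf_ordering_iff)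

lemma primeideal_cinf_Spec: "p \<in> cinf_Spec A \<Longrightarrow> primeideal p R"
  by (simp add: cinf_Spec_def)

lemma in_nonneg_iff: "a \<in> nonneg A p \<longleftrightarrow> a \<in> carrier A \<and> pos_part A (\<ominus>\<^bsub>R\<^esub> a) \<in> p"
  by (simp add: nonneg_def)

lemma uminus_in_nonneg_iff: "a \<in> carrier A \<Longrightarrow> \<ominus>\<^bsub>R\<^esub> a \<in> nonneg A p \<longleftrightarrow> pos_part A a \<in> p"
  by (simp add: in_nonneg_iff)

lemma ideal_cinf_Spec: "p \<in> cinf_Spec A \<Longrightarrow> ideal p R"
  using primeideal_cinf_Spec primeideal.axioms(1) by blast

text \<open>For each real t, one of k(t) and k(-t) is zero. The product of the two parts is
  therefore zero, and \<open>p\<close> is prime. This will give totality of the ordering.\<close>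

lemma pos_part_or_uminus:
  assumes "p \<in> cinf_Spec A" "a \<in> carrier A"
  shows "pos_part A a \<in> p \<or> pos_part A (\<ominus>\<^bsub>R\<^esub> a) \<in> p"
proof -
  interpret p: primeideal p R by (rule primeideal_cinf_Spec[OF assms(1)])
  have "\<zero>\<^bsub>R\<^esub> \<in> p" by (rule additive_subgroup.zero_closed[OF p.is_additive_subgroup])
  then show ?thesis
    using p.I_prime[of "pos_part A a" "pos_part A (\<ominus>\<^bsub>R\<^esub> a)"] assms(2)
    by (simp add: pos_part_mult_pos_part_uminus carrier_iff)
qed

text \<open>The function k(t) + k(-t) vanishes only at t = 0, so the Nullstellensatz leads from it
  to t. Conversely k(t) and k(-t) both vanish at t = 0.\<close>

lemma pos_part_both_iff:
  assumes p: "p \<in> cinf_Spec A" and a: "a \<in> carrier A"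
  shows "pos_part A a \<in> p \<and> pos_part A (\<ominus>\<^bsub>R\<^esub> a) \<in> p \<longleftrightarrow> a \<in> p"
proof
  interpret p: ideal p R by (rule ideal_cinf_Spec[OF p])
  let ?k = "flat (1/2)"
  assume "pos_part A a \<in> p \<and> pos_part A (\<ominus>\<^bsub>R\<^esub> a) \<in> p"
  then have "pos_part A a \<oplus>\<^bsub>R\<^esub> pos_part A (\<ominus>\<^bsub>R\<^esub> a) \<in> p"
    by (simp add: additive_subgroup.a_closed p.is_additive_subgroup)
  moreover have "oper A (\<lambda>x. ?k (x ! 0) + ?k (- x ! 0)) [a] = pos_part A a \<oplus>\<^bsub>R\<^esub> pos_part A (\<ominus>\<^bsub>R\<^esub> a)"
    using a by (subst oper_add)
      (auto simp: oper_pos_part_uminus pos_part_def intro!: smooth_fun_intros)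
  ultimately have "oper A (\<lambda>x. ?k (x ! 0) + ?k (- x ! 0)) [a] \<in> p" by simp
  then have "oper A (\<lambda>x. x ! 0) [a] \<in> p"
  proof (rule nullstellensatz[OF p, rotated -1])
    show "x ! 0 = 0" if "?k (x ! 0) + ?k (- x ! 0) = 0" for x
      using that by (auto simp: flat_def split: if_splits)
  qed (use a in \<open>auto intro!: smooth_fun_intros\<close>)
  then show "a \<in> p" using proj[of 0 "[a]"] a by simp
next
  assume "a \<in> p"
  then have *: "oper A (\<lambda>x. x ! 0) [a] \<in> p" using proj[of 0 "[a]"] a by simp
  have "oper A (\<lambda>x. flat (1/2) (x ! 0)) [a] \<in> p"
    by (rule nullstellensatz[OF p _ _ _ _ *]) (use a in \<open>auto intro!: smooth_fun_intros\<close>)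
  moreover have "oper A (\<lambda>x. flat (1/2) (- x ! 0)) [a] \<in> p"
    by (rule nullstellensatz[OF p _ _ _ _ *]) (use a in \<open>auto intro!: smooth_fun_intros\<close>)
  ultimately show "pos_part A a \<in> p \<and> pos_part A (\<ominus>\<^bsub>R\<^esub> a) \<in> p"
    using a by (simp add: oper_pos_part_uminus pos_part_def)
qed

text \<open>Treats sum and product at once. The sum of squares \<open>?f\<close> is zero exactly
  where both arguments are nonnegative; there \<open>h\<close> is nonnegative, hence k(-h) is zero
  and the Nullstellensatz applies.\<close>

lemma nonneg_binop:
  assumes p: "p \<in> cinf_Spec A" and ab: "a \<in> nonneg A p" "b \<in> nonneg A p"
    and h: "smooth_fun 2 h" "\<And>x. x ! 0 \<ge> 0 \<Longrightarrow> x ! 1 \<ge> 0 \<Longrightarrow> h x \<ge> 0"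
  shows "oper A h [a, b] \<in> nonneg A p"
proof -
  interpret p: ideal p R by (rule ideal_cinf_Spec[OF p])
  let ?k = "flat (1/2)"
  let ?f = "\<lambda>x. ?k (- x ! 0) * ?k (- x ! 0) + ?k (- x ! 1) * ?k (- x ! 1)"
  let ?a = "pos_part A (\<ominus>\<^bsub>R\<^esub> a)" and ?b = "pos_part A (\<ominus>\<^bsub>R\<^esub> b)"
  have abA: "a \<in> carrier A" "b \<in> carrier A" using ab by (auto simp: in_nonneg_iff)
  have ab_p: "?a \<in> p" "?b \<in> p" using ab by (auto simp: in_nonneg_iff)
  have h': "smooth_fun (length [a, b]) h" using h(1) by (simp add: numeral_2_eq_2)
  have s: "smooth_fun (length [a, b]) (\<lambda>x. - x ! 0)" "smooth_fun (length [a, b]) (\<lambda>x. - x ! 1)"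
    by (auto intro!: smooth_fun_intros)
  have o: "oper A (\<lambda>x. - x ! 0) [a, b] = \<ominus>\<^bsub>R\<^esub> a" "oper A (\<lambda>x. - x ! 1) [a, b] = \<ominus>\<^bsub>R\<^esub> b"
    using abA proj[of 0 "[a, b]"] proj[of 1 "[a, b]"] by (simp_all add: oper_uminus smooth_fun_proj)
  have ka: "oper A (\<lambda>x. ?k (- x ! 0)) [a, b] = ?a" and kb: "oper A (\<lambda>x. ?k (- x ! 1)) [a, b] = ?b"
    using oper_flat_half[OF s(1)] oper_flat_half[OF s(2)] abA o by simp_all
  have sk: "smooth_fun (length [a, b]) (\<lambda>x. ?k (- x ! 0))" "smooth_fun (length [a, b]) (\<lambda>x. ?k (- x ! 1))"
    using s by (auto intro!: smooth_fun_intros)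
  have "oper A ?f [a, b] = ?a \<otimes>\<^bsub>R\<^esub> ?a \<oplus>\<^bsub>R\<^esub> ?b \<otimes>\<^bsub>R\<^esub> ?b"
    using abA sk by (simp add: oper_add oper_mult smooth_fun_mult ka[simplified] kb[simplified])
  also have "\<dots> \<in> p"
    using ab_p p.Icarr
    by (intro additive_subgroup.a_closed[OF p.is_additive_subgroup] p.I_l_closed) auto
  finally have "oper A ?f [a, b] \<in> p" .
  then have "oper A (\<lambda>x. ?k (- h x)) [a, b] \<in> p"
  proof (rule nullstellensatz[OF p, rotated -1])
    show "?k (- h x) = 0" if "?f x = 0" for x
      using that h(2)[of x] by (simp add: sum_squares_eq_zero_iff)
  qed (use abA sk h' in \<open>auto intro!: smooth_fun_intros\<close>)
  then have "pos_part A (\<ominus>\<^bsub>R\<^esub> oper A h [a, b]) \<in> p"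
    using oper_flat_half[OF smooth_fun_minus[OF h']] oper_uminus[OF _ h'] abA by simp
  then show ?thesis using closed[OF h'] abA by (simp add: in_nonneg_iff)
qed

lemma cinf_ordering_nonneg:
  assumes p: "p \<in> cinf_Spec A"
  shows "cinf_ordering A (nonneg A p)" "cinf_supp A (nonneg A p) = p"
proof -
  have supp: "{a \<in> nonneg A p. \<ominus>\<^bsub>R\<^esub> a \<in> nonneg A p} = p"
    using pos_part_both_iff[OF p] ideal.Icarr[OF ideal_cinf_Spec[OF p]] unfolding carrier_iff
    by (auto simp: in_nonneg_iff) blast+
  have "a \<oplus>\<^bsub>R\<^esub> b \<in> nonneg A p \<and> a \<otimes>\<^bsub>R\<^esub> b \<in> nonneg A p" if "a \<in> nonneg A p" "b \<in> nonneg A p" for a b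
    unfolding underlying_ring_simps
    using that by (auto intro!: nonneg_binop[OF p] smooth_fun_intros)
  moreover have "a \<in> nonneg A p \<or> \<ominus>\<^bsub>R\<^esub> a \<in> nonneg A p" if "a \<in> carrier A" for a
    using pos_part_or_uminus[OF p that] that by (auto simp: in_nonneg_iff uminus_in_nonneg_iff)
  ultimately show "cinf_ordering A (nonneg A p)"
    using supp p by (auto simp: cinf_ordering_iff in_nonneg_iff)
  then show "cinf_supp A (nonneg A p) = p" using supp by (simp add: cinf_supp_eq)
qed

section \<open>Uniqueness of the ordering with a given support\<close>

lemma cinf_supp_in_Spec: "cinf_ordering A P \<Longrightarrow> cinf_supp A P \<in> cinf_Spec A"
  by (simp add: cinf_supp_eq) (simp add: cinf_ordering_iff)

lemma square_in_ordering:
  assumes P: "cinf_ordering A P" and a: "a \<in> carrier A"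
  shows "a \<otimes>\<^bsub>R\<^esub> a \<in> P"
proof -
  consider "a \<in> P" | "\<ominus>\<^bsub>R\<^esub> a \<in> P" using P a by (auto simp: cinf_ordering_iff)
  then show ?thesis
  proof cases
    case 1
    then show ?thesis using P by (simp add: cinf_ordering_iff)
  next
    case 2
    then have "\<ominus>\<^bsub>R\<^esub> a \<otimes>\<^bsub>R\<^esub> \<ominus>\<^bsub>R\<^esub> a \<in> P" using P by (auto simp: cinf_ordering_iff)
    then show ?thesis using a by (simp add: carrier_iff R.l_minus R.r_minus R.minus_minus)
  qed
qed

text \<open>Let n be the negative part of an element \<open>a\<close> of \<open>P\<close>, so that
  n^2 = -a m^2. Then -n^2 = a m^2 is in \<open>P\<close>, and so is the square n^2. Hence n^2 is in
  the support, and n as well because the support is prime.\<close>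

lemma ordering_eq_nonneg:
  assumes P: "cinf_ordering A P"
  shows "P = nonneg A (cinf_supp A P)"
proof -
  let ?p = "cinf_supp A P"
  have p: "?p \<in> cinf_Spec A" using P by (rule cinf_supp_in_Spec)
  interpret p: primeideal ?p R by (rule primeideal_cinf_Spec[OF p])
  have PA: "P \<subseteq> carrier A" using P by (simp add: cinf_ordering_iff)
  have sub: "a \<in> nonneg A ?p" if "a \<in> P" for a
  proof -
    have a: "a \<in> carrier A" using that PA by auto
    let ?n = "pos_part A (\<ominus>\<^bsub>R\<^esub> a)"
    obtain m where m: "m \<in> carrier A" "?n \<otimes>\<^bsub>R\<^esub> ?n = \<ominus>\<^bsub>R\<^esub> a \<otimes>\<^bsub>R\<^esub> (m \<otimes>\<^bsub>R\<^esub> m)"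
      using pos_part_square[of "\<ominus>\<^bsub>R\<^esub> a"] a by auto
    have "a \<otimes>\<^bsub>R\<^esub> (m \<otimes>\<^bsub>R\<^esub> m) \<in> P"
      using P that square_in_ordering[OF P m(1)] by (auto simp: cinf_ordering_iff)
    then have "\<ominus>\<^bsub>R\<^esub> (?n \<otimes>\<^bsub>R\<^esub> ?n) \<in> P"
      using a m by (simp add: R.l_minus R.minus_minus carrier_iff)
    moreover have "?n \<otimes>\<^bsub>R\<^esub> ?n \<in> P" using a by (intro square_in_ordering[OF P]) simp
    ultimately have "?n \<otimes>\<^bsub>R\<^esub> ?n \<in> ?p" using P by (simp add: cinf_supp_eq)
    then have "?n \<in> ?p" using p.I_prime[of ?n ?n] a by (auto simp: carrier_iff)
    then show ?thesis using a by (simp add: in_nonneg_iff)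
  qed
  \<comment> \<open>If \<open>a\<close> were outside \<open>P\<close>, then \<open>- a\<close> would
    be in \<open>P\<close> and hence in the constructed ordering. Both parts of \<open>a\<close>
    would then lie in the support, forcing \<open>a\<close> into the support and so into
    \<open>P\<close>.\<close>
  have "a \<in> P" if "a \<in> nonneg A ?p" for a
  proof (rule ccontr)
    assume "a \<notin> P"
    have a: "a \<in> carrier A" using that by (simp add: in_nonneg_iff)
    then have "\<ominus>\<^bsub>R\<^esub> a \<in> P" using P \<open>a \<notin> P\<close> by (auto simp: cinf_ordering_iff)
    then have "\<ominus>\<^bsub>R\<^esub> a \<in> nonneg A ?p" by (rule sub)
    then have "a \<in> ?p"
      using that pos_part_both_iff[OF p a] a by (simp add: in_nonneg_iff uminus_in_nonneg_iff)
    then show False using \<open>a \<notin> P\<close> P by (simp add: cinf_supp_eq)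
  qed
  with sub show ?thesis by blast
qed

lemma bij_betw_cinf_supp: "bij_betw (cinf_supp A) (cinf_Sper A) (cinf_Spec A)"
  by (rule bij_betw_byWitness[where f' = "nonneg A"])
    (auto simp: cinf_Sper_def cinf_ordering_nonneg cinf_supp_in_Spec ordering_eq_nonneg[symmetric])


section \<open>The support map is a homeomorphism\<close>

text \<open>Since \<open>P\<close> contains \<open>a\<close> or \<open>- a\<close>, strict
  positivity of \<open>a\<close> means that \<open>- a\<close> is not in \<open>P\<close>; the
  description of \<open>P\<close> by its support turns this into a condition on the positive part.
  So H(a) corresponds to D(k(a)).\<close>

lemma in_Har_basic_iff:
  assumes P: "P \<in> cinf_Sper A" and a: "a \<in> carrier A"
  shows "P \<in> Har_basic A a \<longleftrightarrow> pos_part A a \<notin> cinf_supp A P"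
proof -
  have P': "cinf_ordering A P" using P by (simp add: cinf_Sper_def)
  have "a \<in> P - cinf_supp A P \<longleftrightarrow> \<ominus>\<^bsub>R\<^esub> a \<notin> P"
    using P' a by (auto simp: cinf_supp_eq cinf_ordering_iff)
  also have "\<dots> \<longleftrightarrow> pos_part A a \<notin> cinf_supp A P"
    by (subst ordering_eq_nonneg[OF P']) (simp add: uminus_in_nonneg_iff a)
  finally show ?thesis using P by (simp add: Har_basic_def)
qed

text \<open>An element lies outside the support exactly if one of its parts does. So D(a)
  corresponds to the union of H(a) and H(-a).\<close>

lemma in_Har_basic_or_uminus_iff:
  assumes "P \<in> cinf_Sper A" "a \<in> carrier A"
  shows "P \<in> Har_basic A a \<union> Har_basic A (\<ominus>\<^bsub>R\<^esub> a) \<longleftrightarrow> a \<notin> cinf_supp A P"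
  using assms in_Har_basic_iff pos_part_both_iff[of "cinf_supp A P" a] cinf_supp_in_Spec[of P]
  by (auto simp: cinf_Sper_def)

lemma one_notin_cinf_Spec: "p \<in> cinf_Spec A \<Longrightarrow> \<one>\<^bsub>R\<^esub> \<notin> p"
  using primeideal_cinf_Spec[THEN primeideal.I_notcarr] ideal.one_imp_carrier[OF ideal_cinf_Spec]
  by blast

section \<open>Carriers and subbasic open sets of the two topologies\<close>

lemma topspace_Zar: "topspace (Zar A) = cinf_Spec A"
proof -
  have "p \<in> Zar_basic A \<one>\<^bsub>R\<^esub>" if "p \<in> cinf_Spec A" for p
    using that one_notin_cinf_Spec by (simp add: Zar_basic_def)
  moreover have "Zar_basic A a \<subseteq> cinf_Spec A" for a
    by (auto simp: Zar_basic_def)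
  ultimately show ?thesis
    using ring_ops_closed(5) unfolding Zar_def topology_generated_by_topspace by blast
qed

lemma topspace_Har: "topspace (Har A) = cinf_Sper A"
proof -
  have "P \<in> Har_basic A \<one>\<^bsub>R\<^esub> \<union> Har_basic A (\<ominus>\<^bsub>R\<^esub> \<one>\<^bsub>R\<^esub>)" if "P \<in> cinf_Sper A" for P
    using in_Har_basic_or_uminus_iff[OF that, of "\<one>\<^bsub>R\<^esub>"] one_notin_cinf_Spec cinf_supp_in_Spec[of P] that
    by (simp add: cinf_Sper_def)
  moreover have "Har_basic A a \<subseteq> cinf_Sper A" for a
    by (auto simp: Har_basic_def)
  ultimately show ?thesis
    using ring_ops_closed(1)[OF ring_ops_closed(5)] ring_ops_closed(5)
    unfolding Har_def topology_generated_by_topspace by blast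
qed

lemma openin_Har_basic: "a \<in> carrier A \<Longrightarrow> openin (Har A) (Har_basic A a)"
  unfolding Har_def by (rule topology_generated_by_Basis) simp

lemma openin_Zar_basic: "a \<in> carrier A \<Longrightarrow> openin (Zar A) (Zar_basic A a)"
  unfolding Zar_def by (rule topology_generated_by_Basis) simp

text \<open>Continuity is checked on the generating sets: the preimage of D(a) is the union of H(a)
  and H(-a).\<close>

lemma continuous_map_cinf_supp: "continuous_map (Har A) (Zar A) (cinf_supp A)"
  unfolding Zar_def continuous_on_generated_topo_iff
proof (intro conjI allI impI)
  show "cinf_supp A ` topspace (Har A) \<subseteq> \<Union> (Zar_basic A ` carrier A)"
    using topspace_Zar cinf_supp_in_Spec
    by (auto simp: Zar_def topology_generated_by_topspace topspace_Har cinf_Sper_def)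
  fix U assume "U \<in> Zar_basic A ` carrier A"
  then obtain a where a: "a \<in> carrier A" "U = Zar_basic A a" by blast
  have "cinf_supp A -` U \<inter> topspace (Har A) = Har_basic A a \<union> Har_basic A (\<ominus>\<^bsub>R\<^esub> a)"
    using in_Har_basic_or_uminus_iff[OF _ a(1)] cinf_supp_in_Spec
    by (auto simp: a(2) Zar_basic_def topspace_Har cinf_Sper_def)
      (auto simp: Har_basic_def cinf_Sper_def)
  then show "openin (Har A) (cinf_supp A -` U \<inter> topspace (Har A))"
    using a by (simp add: openin_Har_basic openin_Un)
qed

text \<open>The preimage of H(a) is D(k(a)). Together with the preceding lemma this makes the
  support map a homeomorphism.\<close>

lemma continuous_map_nonneg: "continuous_map (Zar A) (Har A) (nonneg A)"
  unfolding Har_def continuous_on_generated_topo_iff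
proof (intro conjI allI impI)
  show "nonneg A ` topspace (Zar A) \<subseteq> \<Union> (Har_basic A ` carrier A)"
    using topspace_Har cinf_ordering_nonneg(1)
    by (auto simp: Har_def topology_generated_by_topspace topspace_Zar cinf_Sper_def)
  fix U assume "U \<in> Har_basic A ` carrier A"
  then obtain a where a: "a \<in> carrier A" "U = Har_basic A a" by blast
  have "nonneg A -` U \<inter> topspace (Zar A) = Zar_basic A (pos_part A a)"
    using in_Har_basic_iff[OF _ a(1)] cinf_ordering_nonneg
    by (auto simp: a(2) Zar_basic_def topspace_Zar cinf_Sper_def)
  then show "openin (Zar A) (nonneg A -` U \<inter> topspace (Zar A))"
    using a by (simp add: openin_Zar_basic)
qed

text \<open>The preimage of \<open>U\<close> under the support map is the image of \<open>U\<close>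
  under the continuous inverse \<open>nonneg A\<close>, and continuous images preserve
  compactness.\<close>

lemma spectral_map_cinf_supp: "spectral_map (Har A) (Zar A) (cinf_supp A)"
  unfolding spectral_map_def
proof (intro conjI allI impI)
  show "continuous_map (Har A) (Zar A) (cinf_supp A)" by (rule continuous_map_cinf_supp)
  fix U assume "openin (Zar A) U \<and> compactin (Zar A) U"
  then have U: "U \<subseteq> cinf_Spec A" "compactin (Zar A) U"
    using openin_subset topspace_Zar by blast+
  have "{P \<in> topspace (Har A). cinf_supp A P \<in> U} = nonneg A ` U"
    using U(1) cinf_ordering_nonneg ordering_eq_nonneg
    by (force simp: topspace_Har cinf_Sper_def)
  then show "compactin (Har A) {P \<in> topspace (Har A). cinf_supp A P \<in> U}"
    using image_compactin[OF U(2) continuous_map_nonneg] by simp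
qed

end

theorem theorem4p15:
  fixes A :: "'a cinf_struct"
  assumes "cinf_ring A"
  shows "bij_betw (cinf_supp A) (cinf_Sper A) (cinf_Spec A) \<and>
         spectral_map (Har A) (Zar A) (cinf_supp A)"
  using cinf_ring.bij_betw_cinf_supp[OF assms] cinf_ring.spectral_map_cinf_supp[OF assms]
  by (rule conjI)

end
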